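(* Fix $a\in(0,\tfrac12)$ and $\gamma\in(-\sqrt{2a(1-2a)},0)$. For every $\lambda\in[-1-a,-1+a]$ there exists a unique $E=\mathcal E(\lambda)\in(0,1)$ such that the $\Omega$-flow described in the context has a saddles connector. Moreover, $\mathcal E$ is a $C^1$ function and $\big|\frac{d\mathcal E}{d\lambda}\big|<\frac1a$.
   Context: For $a\in(0,\tfrac12)$, $\gamma\in(-\sqrt{2a(1-2a)},0)$, $E\in[0,1)$, $\lambda\in\mathbb R$, the $\Omega$-flow is the system on the strip $[-\tfrac\pi2,\tfrac\pi2]\times\mathbb R$ (with $\Omega$ understood mod $2\pi$ on the cylinder) $$\dot\xi=\cos^2\xi,\qquad \dot\Omega=2a\sin\xi\cos\Omega+2\lambda\cos\xi\sin\Omega+2\gamma\sin\xi\cos\xi+\cos^2\xi-2aE,$$ (the radial Prüfer equation of the separated Dirac equation with $\kappa=\tfrac12$, units $m=1$, $\gamma=-eQ$). With $\arccos$ the principal branch in $[0,\pi]$, the saddle equilibria are $\tilde S_-=(-\tfrac\pi2,-\pi+\arccos E)$ and $\tilde S_+=(\tfrac\pi2,-\arccos E)$. A saddles connector is an orbit in the open strip whose $\alpha$-limit is $\tilde S_-$ and whose $\omega$-limit is $\tilde S_+$. *)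

theory Defs
  imports "HOL-Analysis.Analysis"
begin

definition omega_field :: "real \<Rightarrow> real \<Rightarrow> real \<Rightarrow> real \<Rightarrow> real \<times> real \<Rightarrow> real \<times> real" where
  "omega_field a \<gamma> E \<mu> p = (let \<xi> = fst p; \<Omega> = snd p in
     ((cos \<xi>)\<^sup>2,
      2 * a * sin \<xi> * cos \<Omega> + 2 * \<mu> * cos \<xi> * sin \<Omega> + 2 * \<gamma> * sin \<xi> * cos \<xi>
        + (cos \<xi>)\<^sup>2 - 2 * a * E))"

definition saddle_minus :: "real \<Rightarrow> real \<times> real" where
  "saddle_minus E = (- pi / 2, - pi + arccos E)"

definition saddle_plus :: "real \<Rightarrow> real \<times> real" where
  "saddle_plus E = (pi / 2, - arccos E)"

text \<open>A saddles connector: a (global) solution curve lying in the open strip whose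
  alpha-limit is the saddle S_- and whose omega-limit is the saddle S_+
  (as the specified points of the strip, i.e. in the lifted coordinates).\<close>
definition has_saddles_connector :: "real \<Rightarrow> real \<Rightarrow> real \<Rightarrow> real \<Rightarrow> bool" where
  "has_saddles_connector a \<gamma> E \<mu> \<longleftrightarrow>
     (\<exists>x :: real \<Rightarrow> real \<times> real.
        (\<forall>t. (x has_vector_derivative omega_field a \<gamma> E \<mu> (x t)) (at t)) \<and>
        (\<forall>t. fst (x t) \<in> {- pi / 2 <..< pi / 2}) \<and>
        (x \<longlongrightarrow> saddle_minus E) at_bot \<and>
        (x \<longlongrightarrow> saddle_plus E) at_top)"

end

theory Submission
  imports Defs "HOL-Probability.Sinc_Integral" "HOL-Real_Asymp.Real_Asymp"
begin

text \<open>In the time \<open>s = tan \<xi>\<close> the flow becomes a scalar equation for \<open>\<Omega>\<close>, in which exactly one orbit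
  \<open>W\<^sup>+\<close> tends to \<open>S\<^sub>+\<close> forwards and exactly one orbit \<open>W\<^sup>-\<close> tends to \<open>S\<^sub>-\<close> backwards; a connector is a
  coincidence of the two. Both depend continuously on \<open>E\<close>, and barriers show \<open>W\<^sup>+ < - \<pi>/2 < W\<^sup>-\<close> at
  \<open>E = 0\<close> but \<open>W\<^sup>- < W\<^sup>+\<close> at some point for \<open>E\<close> close to \<open>1\<close>, so some \<open>E\<close> between has a connector. The
  difference of two connectors solves a linear equation whose integrating factor \<open>w > 0\<close> decays at
  both ends, because the saddles are hyperbolic. Integrating over the line gives
  \<open>a (E\<^sub>2 - E\<^sub>1) \<integral> w = (\<lambda>\<^sub>2 - \<lambda>\<^sub>1) \<integral> w cos \<xi> sin \<Omega>\<^sub>2\<close>; dominated convergence turns this into a formula for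
  \<open>d\<E>/d\<lambda>\<close> which is visibly continuous and smaller than \<open>1 / a\<close> in absolute value. The
  parameter \<open>\<lambda>\<close> is written \<open>\<mu>\<close> below.\<close>

section \<open>Scalar differential equations\<close>

text \<open>The reflection \<open>(s, y) -> (- s, - pi - y)\<close> exchanges the two saddles and
  changes only the sign of \<open>\<gamma>\<close>. So the analysis near a saddle is done once, for
  limits at \<open>at_top\<close> and either sign of \<open>\<gamma>\<close>. The lower bound on
  \<open>\<gamma>\<close> enters as \<open>\<bar>\<gamma>\<bar> < 1 / 2\<close>, because
  \<open>2 * a * (1 - 2 * a) \<le> 1 / 4\<close>. The obstacle is that an orbit into a saddle is
  fixed by its limit and not by an initial value, so Gronwall alone does not control how it depends
  on the parameters. Hyperbolicity does: bounded differences that are repelled forwards must already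
  be small at a time \<open>S\<close> that is uniform over nearby parameters. The same uniform rate
  later supplies the dominating functions. The mean identity is applied with tail bounds for
  energies near a common value. A crossing argument therefore comes first and gives uniqueness and
  Lipschitz continuity of \<open>\<E>\<close>. After that the identity is an exact secant formula,
  and \<open>\<E>\<close> is differentiated without differentiating the flow in its
  parameters.\<close>

lemma strict_mono_barrier:
  fixes D D' :: "real \<Rightarrow> real"
  assumes D: "\<And>t. p \<le> t \<Longrightarrow> t \<le> q \<Longrightarrow> (D has_real_derivative D' t) (at t)"
    and up: "\<And>t. p \<le> t \<Longrightarrow> t \<le> q \<Longrightarrow> D t = 0 \<Longrightarrow> D' t > 0"
    and "0 \<le> D p" "p < q"
  shows "0 < D q"
proof (rule ccontr)
  assume "\<not> 0 < D q"
  have pos_right: "\<exists>d>0. \<forall>t. p < t \<and> t < p + d \<longrightarrow> D t > 0"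
  proof (cases "D p = 0")
    case True
    then obtain d where "d > 0" "\<forall>h>0. h < d \<longrightarrow> D p < D (p + h)"
      using DERIV_pos_inc_right[OF D[of p] up[of p]] \<open>p < q\<close> by auto
    then show ?thesis using True
      by (metis add.commute diff_add_cancel less_diff_eq diff_gt_0_iff_gt add_diff_cancel_left')
  next
    case False
    have "isCont D p" using DERIV_isCont[OF D[of p]] \<open>p < q\<close> by simp
    then have "\<forall>\<^sub>F t in at p. D t > 0"
      using False \<open>0 \<le> D p\<close> by (auto simp: isCont_def intro: order_tendstoD)
    then obtain d where "d > 0" "\<forall>t. t \<noteq> p \<and> dist t p < d \<longrightarrow> D t > 0"
      by (auto simp: eventually_at)
    then show ?thesis
      by (intro exI[of _ d]) (auto simp: dist_real_def)
  qed
  then obtain d where d: "d > 0" "\<And>t. p < t \<Longrightarrow> t < p + d \<Longrightarrow> D t > 0" by auto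
  \<comment> \<open>The search for the first failure starts at \<open>p + d/2\<close> because
    \<open>D p = 0\<close> is allowed. At that first failure \<open>t\<close> continuity forces
    \<open>D t = 0\<close>, so \<open>D' t > 0\<close> makes \<open>D\<close> negative just before
    \<open>t\<close>, against \<open>before\<close>.\<close>
  define Z where "Z = {t. p + d/2 \<le> t \<and> t \<le> q \<and> D t \<le> 0}"
  have pd: "p + d \<le> q" using d \<open>\<not> 0 < D q\<close> \<open>p < q\<close> by force
  have "continuous_on {p..q} D"
    using D by (intro DERIV_continuous_on[where D=D'] ballI) (auto intro: has_field_derivative_at_within)
  then have "continuous_on {p + d/2..q} D"
    by (rule continuous_on_subset) (use d in auto)
  then have "closed ({p + d/2..q} \<inter> D -` {..0})"
    by (intro continuous_closed_preimage) auto
  moreover have "{p + d/2..q} \<inter> D -` {..0} = Z" by (auto simp: Z_def)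
  ultimately have "closed Z" by simp
  moreover have bb: "bdd_below Z" by (auto simp: Z_def intro: bdd_belowI[of _ p] )
  moreover have ne: "q \<in> Z" using pd d \<open>\<not> 0 < D q\<close> by (auto simp: Z_def)
  ultimately have tZ: "Inf Z \<in> Z" by (intro closed_contains_Inf) auto
  define t where "t = Inf Z"
  have t: "p + d/2 \<le> t" "t \<le> q" "D t \<le> 0" using tZ by (auto simp: Z_def t_def)
  have before: "D u > 0" if "p < u" "u < t" for u
  proof (cases "u < p + d/2")
    case True then show ?thesis using d that by auto
  next
    case False
    have "u \<notin> Z" using that(2) cInf_lower[OF _ bb, of u] by (auto simp: t_def)
    then show ?thesis using False that t by (auto simp: Z_def)
  qed
  have pt: "p < t" using t d by linarith
  have "isCont D t" using DERIV_isCont[OF D[of t]] t pt by simp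
  then have "(D \<longlongrightarrow> D t) (at_left t)" by (auto simp: isCont_def filterlim_at_split)
  moreover have "\<forall>\<^sub>F u in at_left t. 0 \<le> D u"
    unfolding eventually_at_left[OF pt] using before pt less_imp_le by blast
  ultimately have "0 \<le> D t" by (intro tendsto_lowerbound) auto
  then have "D t = 0" using t by simp
  then have "D' t > 0" using up t pt by simp
  then obtain e where "e > 0" "\<forall>h>0. h < e \<longrightarrow> D (t - h) < D t"
    using DERIV_pos_inc_left[OF D[of t]] t pt by auto
  moreover have "min (e/2) ((t-p)/2) > 0" "min (e/2) ((t-p)/2) < e" using \<open>e>0\<close> pt by auto
  ultimately have "D (t - min (e/2) ((t-p)/2)) < 0" using \<open>D t = 0\<close> by auto
  moreover have "D (t - min (e/2) ((t-p)/2)) > 0"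
    by (rule before) (use \<open>e > 0\<close> pt in \<open>auto simp: min_def field_simps\<close>)
  ultimately show False by simp
qed

lemma real_antiderivative:
  fixes f :: "real \<Rightarrow> real"
  assumes "continuous_on UNIV f"
  obtains G where "G 0 = 0" "\<And>s. (G has_real_derivative f s) (at s)"
proof -
  have "\<exists>G. \<forall>x::real. - \<infinity> < ereal x \<longrightarrow> ereal x < \<infinity> \<longrightarrow> (G has_vector_derivative f x) (at x)"
    using assms by (intro einterval_antiderivative) (auto simp: continuous_on_eq_continuous_at)
  then obtain G where G: "\<And>x. (G has_real_derivative f x) (at x)"
    by (auto simp: has_real_derivative_iff_has_vector_derivative)
  show ?thesis
    by (rule that[of "\<lambda>s. G s - G 0"]) (auto intro!: derivative_eq_intros G)
qed

text \<open>Integrating from 0 a function that grows like \<open>exp (K * \<bar>s\<bar>)\<close>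
  gains a factor \<open>1 / K\<close>. In the contraction argument for the initial value problem
  this factor beats the Lipschitz constant once \<open>K\<close> is large.\<close>

lemma exp_bound_of_derivative:
  fixes G g :: "real \<Rightarrow> real"
  assumes G: "\<And>s. (G has_real_derivative g s) (at s)" "G 0 = 0"
    and g: "\<And>s. \<bar>g s\<bar> \<le> M * K * exp (K * \<bar>s\<bar>)" and "0 \<le> M"
  shows "\<bar>G s\<bar> \<le> M * exp (K * \<bar>s\<bar>)"
proof -
  have nonneg: "\<bar>H s\<bar> \<le> M * exp (K * s)"
    if "0 \<le> s" and H: "\<And>s. (H has_real_derivative h s) (at s)" "H 0 = 0"
      and h: "\<And>s. \<bar>h s\<bar> \<le> M * K * exp (K * \<bar>s\<bar>)" for H h :: "real \<Rightarrow> real" and s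
  proof -
    have "M * exp (K * 0) - c * H 0 \<le> M * exp (K * s) - c * H s" if c: "c = 1 \<or> c = -1" for c
    proof (rule DERIV_nonneg_imp_nondecreasing[OF \<open>0 \<le> s\<close>])
      fix x :: real assume x: "0 \<le> x" "x \<le> s"
      have "((\<lambda>s. M * exp (K * s) - c * H s) has_real_derivative (M * (K * exp (K * x)) - c * h x)) (at x)"
        by (auto intro!: derivative_eq_intros H)
      moreover have "0 \<le> M * (K * exp (K * x)) - c * h x"
        using h[of x] x c by (auto simp: mult_ac abs_le_iff)
      ultimately show "\<exists>y. ((\<lambda>s. M * exp (K * s) - c * H s) has_real_derivative y) (at x) \<and> 0 \<le> y"
        by blast
    qed
    from this[of 1] this[of "-1"] show ?thesis using H \<open>0 \<le> M\<close> by (auto simp: abs_le_iff)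
  qed
  show ?thesis
  proof (cases "0 \<le> s")
    case True then show ?thesis using nonneg[of s G g] G g by auto
  next
    case False
    have "((\<lambda>s. G (- s)) has_real_derivative - g (- x)) (at x)" for x
      using G(1)[of "- x"] by (simp add: DERIV_mirror)
    from nonneg[OF _ this, of "- s"] show ?thesis using False G(2) g
      by (metis abs_minus_cancel abs_of_neg add.inverse_inverse less_eq_real_def linorder_not_less minus_zero neg_0_le_iff_le)
  qed
qed

text \<open>Picard iteration on the whole line at once, in a weighted sup norm: the unknown is the
  bounded function \<open>v = exp (- (K * \<bar>s\<bar>)) * (y - y0)\<close>. Boundedness of
  \<open>F\<close> keeps the iterates bounded, and the Lipschitz condition makes \<open>T\<close> a
  contraction with factor \<open>L / K\<close>.\<close>

lemma Lipschitz_ode_solution_at_0: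
  fixes F :: "real \<Rightarrow> real \<Rightarrow> real"
  assumes cont: "continuous_on UNIV (\<lambda>p. F (fst p) (snd p))"
    and bd: "\<And>s y. \<bar>F s y\<bar> \<le> B"
    and lip: "\<And>s x y. \<bar>F s x - F s y\<bar> \<le> L * \<bar>x - y\<bar>" and "L > 0"
  shows "\<exists>y. y 0 = y0 \<and> (\<forall>s. (y has_real_derivative F s (y s)) (at s))"
proof -
  \<comment> \<open>This choice makes the contraction factor \<open>L / K\<close> equal to
    \<open>1/2\<close>.\<close>
  define K where "K = 2 * L"
  have K: "K > 0" using \<open>L > 0\<close> by (simp add: K_def)
  have B: "0 \<le> B" using bd[of 0 0] by simp
  define f where "f = (\<lambda>(v :: real \<Rightarrow>\<^sub>C real) s. F s (y0 + exp (K * \<bar>s\<bar>) * apply_bcontfun v s))"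
  have f_cont: "continuous_on UNIV (f v)" for v
    unfolding f_def
    by (rule continuous_on_compose2[OF cont, of _ "\<lambda>s. (s, y0 + exp (K * \<bar>s\<bar>) * apply_bcontfun v s)", simplified])
       (auto intro!: continuous_intros)
  have "\<exists>G. G 0 = 0 \<and> (\<forall>s. (G has_real_derivative f v s) (at s))" for v
    using real_antiderivative[OF f_cont] by metis
  then obtain G where G: "\<And>v. G v 0 = 0" "\<And>v s. (G v has_real_derivative f v s) (at s)"
    by metis
  define g where "g = (\<lambda>v s. exp (- (K * \<bar>s\<bar>)) * G v s)"
  have exp1: "x \<le> x * exp (K * \<bar>s\<bar>)" if "0 \<le> x" for x s :: real
    using that K by (simp add: mult_le_cancel_left1)
  have "\<bar>G v s\<bar> \<le> B / K * exp (K * \<bar>s\<bar>)" for v s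
  proof (rule exp_bound_of_derivative[OF G(2) G(1)])
    show "\<bar>f v t\<bar> \<le> B / K * K * exp (K * \<bar>t\<bar>)" for t
      using bd[of t "y0 + exp (K * \<bar>t\<bar>) * apply_bcontfun v t"] exp1[OF B, of t] K by (simp add: f_def)
  qed (use B K in auto)
  then have g_bd: "\<bar>g v s\<bar> \<le> B / K" for v s
    unfolding g_def abs_mult by (simp add: exp_minus field_simps)
  have "continuous_on UNIV (G v)" for v
    by (rule DERIV_continuous_on[where D="f v"]) (rule has_field_derivative_at_within[OF G(2)])
  then have g_b: "g v \<in> bcontfun" for v
    using g_bd[of v] unfolding g_def
    by (intro bcontfun_normI[where b="B/K"] continuous_intros) auto
  define T where "T = (\<lambda>v. Bcontfun (g v))"
  have T: "apply_bcontfun (T v) s = g v s" for v s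
    using g_b by (simp add: T_def Bcontfun_inverse)
  have "\<bar>G v s - G w s\<bar> \<le> dist v w / 2 * exp (K * \<bar>s\<bar>)" for v w s
  proof (rule exp_bound_of_derivative[where G="\<lambda>s. G v s - G w s" and g="\<lambda>s. f v s - f w s"])
    show "((\<lambda>s. G v s - G w s) has_real_derivative f v t - f w t) (at t)" for t
      by (intro derivative_intros G)
    fix t
    have "\<bar>f v t - f w t\<bar> \<le> L * \<bar>exp (K * \<bar>t\<bar>) * (apply_bcontfun v t - apply_bcontfun w t)\<bar>"
      using lip[of t "y0 + exp (K * \<bar>t\<bar>) * apply_bcontfun v t" "y0 + exp (K * \<bar>t\<bar>) * apply_bcontfun w t"]
      by (simp add: f_def right_diff_distrib)
    also have "\<dots> = L * (exp (K * \<bar>t\<bar>) * dist (apply_bcontfun v t) (apply_bcontfun w t))"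
      by (simp add: abs_mult dist_real_def)
    also have "\<dots> \<le> L * (exp (K * \<bar>t\<bar>) * dist v w)"
      using \<open>L > 0\<close> by (intro mult_left_mono dist_bounded) auto
    also have "\<dots> = dist v w / 2 * K * exp (K * \<bar>t\<bar>)" by (simp add: K_def)
    finally show "\<bar>f v t - f w t\<bar> \<le> dist v w / 2 * K * exp (K * \<bar>t\<bar>)" .
  qed (auto simp: G)
  then have "\<bar>g v s - g w s\<bar> \<le> dist v w / 2" for v w s
    unfolding g_def right_diff_distrib[symmetric] abs_mult by (simp add: exp_minus field_simps)
  then have "dist (T v) (T w) \<le> 1/2 * dist v w" for v w
    by (intro dist_bound) (simp add: T dist_real_def)
  then have "\<exists>!v. T v = v"
    by (intro banach_fix_type[where c="1/2"]) auto
  then obtain v where "T v = v" by auto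
  then have v: "exp (K * \<bar>s\<bar>) * apply_bcontfun v s = G v s" for s
    using T[of v s] by (simp add: g_def exp_minus field_simps)
  show ?thesis
  proof (intro exI[of _ "\<lambda>s. y0 + G v s"] conjI allI)
    show "y0 + G v 0 = y0" by (simp add: G)
    show "((\<lambda>s. y0 + G v s) has_real_derivative F s (y0 + G v s)) (at s)" for s
      using G(2)[of v s] by (auto intro!: derivative_eq_intros simp: f_def v)
  qed
qed

lemma Lipschitz_ode_solution:
  fixes F :: "real \<Rightarrow> real \<Rightarrow> real"
  assumes cont: "continuous_on UNIV (\<lambda>p. F (fst p) (snd p))"
    and bd: "\<And>s y. \<bar>F s y\<bar> \<le> B"
    and lip: "\<And>s x y. \<bar>F s x - F s y\<bar> \<le> L * \<bar>x - y\<bar>" and "L > 0"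
  obtains y where "y s0 = y0" "\<And>s. (y has_real_derivative F s (y s)) (at s)"
proof -
  have "continuous_on UNIV (\<lambda>p. F (fst p + s0) (snd p))"
    by (rule continuous_on_compose2[OF cont, of _ "\<lambda>p. (fst p + s0, snd p)", simplified])
       (auto intro!: continuous_intros)
  from Lipschitz_ode_solution_at_0[of "\<lambda>s. F (s + s0)", OF this bd lip \<open>L > 0\<close>, of y0]
  obtain y where y: "y 0 = y0" "\<And>s. (y has_real_derivative F (s + s0) (y s)) (at s)" by auto
  show ?thesis
  proof (rule that[of "\<lambda>s. y (s - s0)"])
    show "((\<lambda>s. y (s - s0)) has_real_derivative F s (y (s - s0))) (at s)" for s
      using y(2)[of "s - s0"] DERIV_shift[of y _ s "- s0"] by simp
  qed (simp add: y)
qed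

text \<open>Squares avoid the corner of the absolute value, and adding \<open>r\<^sup>2\<close>
  absorbs the forcing through \<open>2 * \<bar>D\<bar> * r \<le> D\<^sup>2 + r\<^sup>2\<close>. Thus
  \<open>Z = D\<^sup>2 + r\<^sup>2\<close> satisfies
  \<open>\<bar>Z'\<bar> \<le> (2 * L + 1) * Z\<close>, which can be integrated in both time
  directions.\<close>

lemma square_Gronwall:
  fixes D D' :: "real \<Rightarrow> real"
  assumes D: "\<And>s. (D has_real_derivative D' s) (at s)"
    and bd: "\<And>s. \<bar>D' s\<bar> \<le> L * \<bar>D s\<bar> + r" and "0 \<le> L"
  shows "(D s)\<^sup>2 + r\<^sup>2 \<le> exp ((2 * L + 1) * \<bar>s - t\<bar>) * ((D t)\<^sup>2 + r\<^sup>2)"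
proof -
  let ?K = "2 * L + 1"
  define Z where "Z = (\<lambda>x. (D x)\<^sup>2 + r\<^sup>2)"
  have Z: "(Z has_real_derivative 2 * (D x * D' x)) (at x)" for x
    unfolding Z_def by (auto intro!: derivative_eq_intros D)
  have Z': "2 * \<bar>D x * D' x\<bar> \<le> ?K * Z x" for x
  proof -
    have "2 * \<bar>D x * D' x\<bar> \<le> 2 * (\<bar>D x\<bar> * (L * \<bar>D x\<bar> + r))"
      unfolding abs_mult using bd[of x] by (intro mult_left_mono) auto
    also have "\<dots> = 2 * L * (D x)\<^sup>2 + 2 * \<bar>D x\<bar> * r"
      by (simp add: algebra_simps power2_eq_square)
    also have "2 * \<bar>D x\<bar> * r \<le> (D x)\<^sup>2 + r\<^sup>2"
      using sum_squares_bound[of "\<bar>D x\<bar>" r] by simp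
    also have "2 * L * (D x)\<^sup>2 \<le> 2 * L * ((D x)\<^sup>2 + r\<^sup>2)"
      using \<open>0 \<le> L\<close> by (intro mult_left_mono) auto
    finally show ?thesis by (simp add: Z_def algebra_simps)
  qed
  have "Z s \<le> exp (?K * \<bar>s - t\<bar>) * Z t"
  proof (cases "t \<le> s")
    case True
    have "exp (- (?K * s)) * Z s \<le> exp (- (?K * t)) * Z t"
    proof (rule DERIV_nonpos_imp_nonincreasing[OF True])
      fix x
      have "((\<lambda>x. exp (- (?K * x)) * Z x) has_real_derivative
               exp (- (?K * x)) * (2 * (D x * D' x) - ?K * Z x)) (at x)"
        by (auto intro!: derivative_eq_intros Z simp: algebra_simps)
      moreover have "exp (- (?K * x)) * (2 * (D x * D' x) - ?K * Z x) \<le> 0"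
        using Z'[of x] by (intro mult_nonneg_nonpos) auto
      ultimately show "\<exists>y. ((\<lambda>x. exp (- (?K * x)) * Z x) has_real_derivative y) (at x) \<and> y \<le> 0"
        by blast
    qed
    then have "exp (?K * s) * (exp (- (?K * s)) * Z s) \<le> exp (?K * s) * (exp (- (?K * t)) * Z t)"
      by (intro mult_left_mono) auto
    then show ?thesis
      using True by (simp add: mult.assoc[symmetric] exp_add[symmetric] right_diff_distrib)
  next
    case False
    then have le: "s \<le> t" by simp
    have "exp (?K * s) * Z s \<le> exp (?K * t) * Z t"
    proof (rule DERIV_nonneg_imp_nondecreasing[OF le])
      fix x
      have "((\<lambda>x. exp (?K * x) * Z x) has_real_derivative
               exp (?K * x) * (2 * (D x * D' x) + ?K * Z x)) (at x)"
        by (auto intro!: derivative_eq_intros Z simp: algebra_simps)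
      moreover have "exp (?K * x) * (2 * (D x * D' x) + ?K * Z x) \<ge> 0"
        using Z'[of x] by (intro mult_nonneg_nonneg) auto
      ultimately show "\<exists>y. ((\<lambda>x. exp (?K * x) * Z x) has_real_derivative y) (at x) \<and> 0 \<le> y"
        by blast
    qed
    then have "exp (- (?K * s)) * (exp (?K * s) * Z s) \<le> exp (- (?K * s)) * (exp (?K * t) * Z t)"
      by (intro mult_left_mono) auto
    then show ?thesis
      using False by (simp add: mult.assoc[symmetric] exp_add[symmetric] right_diff_distrib)
  qed
  then show ?thesis by (simp add: Z_def)
qed

text \<open>If the linear part repels at least at rate \<open>\<kappa>\<close>, a bounded solution never leaves the
  quasi-static range \<open>r / \<kappa>\<close>: beyond it, it would grow exponentially.\<close>

lemma bounded_repelled_bound: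
  fixes D D' c :: "real \<Rightarrow> real"
  assumes D: "\<And>s. S \<le> s \<Longrightarrow> (D has_real_derivative D' s) (at s)"
    and D': "\<And>s. S \<le> s \<Longrightarrow> \<bar>D' s - c s * D s\<bar> \<le> r"
    and c: "\<And>s. S \<le> s \<Longrightarrow> \<kappa> \<le> c s" and "0 < \<kappa>"
    and bd: "\<And>s. S \<le> s \<Longrightarrow> \<bar>D s\<bar> \<le> b"
  shows "\<bar>D S\<bar> \<le> r / \<kappa>"
proof -
  define Z where "Z = (\<lambda>x. (D x)\<^sup>2 - (r/\<kappa>)\<^sup>2)"
  have r: "0 \<le> r" using D'[of S] by linarith
  have Z: "(Z has_real_derivative 2 * (D x * D' x)) (at x)" if "S \<le> x" for x
    unfolding Z_def using that by (auto intro!: derivative_eq_intros D)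
  have Z': "\<kappa> * Z x \<le> 2 * (D x * D' x)" if "S \<le> x" for x
  proof -
    have "\<bar>D x * (D' x - c x * D x)\<bar> \<le> \<bar>D x\<bar> * r"
      unfolding abs_mult using D'[OF that] by (intro mult_left_mono) auto
    then have "D x * D' x \<ge> c x * (D x)\<^sup>2 - \<bar>D x\<bar> * r"
      by (simp add: algebra_simps power2_eq_square abs_le_iff)
    moreover have "c x * (D x)\<^sup>2 \<ge> \<kappa> * (D x)\<^sup>2" using c[OF that] by (intro mult_right_mono) auto
    moreover have "\<kappa> * (2 * \<bar>D x\<bar> * (r/\<kappa>)) \<le> \<kappa> * ((D x)\<^sup>2 + (r/\<kappa>)\<^sup>2)"
      using sum_squares_bound[of "\<bar>D x\<bar>" "r/\<kappa>"] \<open>0 < \<kappa>\<close> by (intro mult_left_mono) auto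
    ultimately show ?thesis using \<open>0 < \<kappa>\<close> by (simp add: Z_def algebra_simps)
  qed
  \<comment> \<open>By \<open>Z'\<close> the function \<open>exp (- (\<kappa> * s)) * Z s\<close>
    cannot decrease. Boundedness of \<open>D\<close> puts it below a function that tends to 0, so it
    is nonpositive from the start.\<close>
  have mono: "exp (- (\<kappa> * S)) * Z S \<le> exp (- (\<kappa> * s)) * Z s" if "S \<le> s" for s
  proof (rule DERIV_nonneg_imp_nondecreasing[OF that])
    fix x assume x: "S \<le> x"
    have "((\<lambda>x. exp (- (\<kappa> * x)) * Z x) has_real_derivative
             exp (- (\<kappa> * x)) * (2 * (D x * D' x) - \<kappa> * Z x)) (at x)"
      by (auto intro!: derivative_eq_intros Z x simp: algebra_simps)
    moreover have "exp (- (\<kappa> * x)) * (2 * (D x * D' x) - \<kappa> * Z x) \<ge> 0"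
      using Z'[OF x] by (intro mult_nonneg_nonneg) auto
    ultimately show "\<exists>y. ((\<lambda>x. exp (- (\<kappa> * x)) * Z x) has_real_derivative y) (at x) \<and> 0 \<le> y"
      by blast
  qed
  have "exp (- (\<kappa> * S)) * Z S \<le> exp (- (\<kappa> * s)) * b\<^sup>2" if "S \<le> s" for s
  proof -
    have "Z s \<le> b\<^sup>2" using power_mono[OF bd[OF that], of 2] by (simp add: Z_def) (smt (verit) zero_le_power2)
    then show ?thesis using mono[OF that] by (smt (verit) exp_gt_zero mult_left_mono)
  qed
  moreover have "((\<lambda>s. exp (- (\<kappa> * s)) * b\<^sup>2) \<longlongrightarrow> 0) at_top"
    using \<open>0 < \<kappa>\<close> by real_asymp
  ultimately have "exp (- (\<kappa> * S)) * Z S \<le> 0"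
    by (intro tendsto_lowerbound[where F=at_top and f="\<lambda>s. exp (- (\<kappa> * s)) * b\<^sup>2"])
       (auto simp: eventually_at_top_linorder)
  then have "(D S)\<^sup>2 \<le> (r/\<kappa>)\<^sup>2" by (simp add: Z_def mult_le_0_iff)
  then have "\<bar>D S\<bar>\<^sup>2 \<le> (r/\<kappa>)\<^sup>2" by simp
  moreover have "0 \<le> r / \<kappa>" using r \<open>0 < \<kappa>\<close> by simp
  ultimately show ?thesis by (rule power2_le_imp_le)
qed

section \<open>The scalar equation and its orbits\<close>

text \<open>Along the flow \<open>tan \<xi>\<close> has derivative 1. Hence \<open>s\<close> is the
  original time up to a constant, and the scalar equation keeps the right-hand side for
  \<open>\<Omega>\<close> unchanged at \<open>\<xi> = arctan s\<close>, without a factor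
  \<open>1 / (cos \<xi>)\<^sup>2\<close>.\<close>

definition slope :: "real \<Rightarrow> real \<Rightarrow> real \<Rightarrow> real \<Rightarrow> real \<Rightarrow> real \<Rightarrow> real" where
  "slope a \<gamma> E \<mu> s y = 2 * a * sin (arctan s) * cos y + 2 * \<mu> * cos (arctan s) * sin y
     + 2 * \<gamma> * sin (arctan s) * cos (arctan s) + (cos (arctan s))\<^sup>2 - 2 * a * E"

definition orbit :: "real \<Rightarrow> real \<Rightarrow> real \<Rightarrow> real \<Rightarrow> (real \<Rightarrow> real) \<Rightarrow> bool" where
  "orbit a \<gamma> E \<mu> y \<longleftrightarrow> (\<forall>s. (y has_real_derivative slope a \<gamma> E \<mu> s (y s)) (at s))"

definition stable_orbit :: "real \<Rightarrow> real \<Rightarrow> real \<Rightarrow> real \<Rightarrow> (real \<Rightarrow> real) \<Rightarrow> bool" where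
  "stable_orbit a \<gamma> E \<mu> y \<longleftrightarrow> orbit a \<gamma> E \<mu> y \<and> (y \<longlongrightarrow> - arccos E) at_top"

definition unstable_orbit :: "real \<Rightarrow> real \<Rightarrow> real \<Rightarrow> real \<Rightarrow> (real \<Rightarrow> real) \<Rightarrow> bool" where
  "unstable_orbit a \<gamma> E \<mu> y \<longleftrightarrow> orbit a \<gamma> E \<mu> y \<and> (y \<longlongrightarrow> - pi + arccos E) at_bot"

lemma orbitD: "orbit a \<gamma> E \<mu> y \<Longrightarrow> (y has_real_derivative slope a \<gamma> E \<mu> s (y s)) (at s)"
  by (simp add: orbit_def)

text \<open>The reflection sends the limit \<open>- arccos E\<close> at one end to
  \<open>- pi + arccos E\<close> at the other. Every result on stable orbits that holds for both
  signs of \<open>\<gamma>\<close> thereby becomes one on unstable orbits.\<close>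

lemma slope_reflect: "slope a \<gamma> E \<mu> (- s) (- pi - y) = slope a (- \<gamma>) E \<mu> s y"
proof -
  have "cos (- pi - y) = - cos y" "sin (- pi - y) = sin y"
    by (simp_all add: cos_diff sin_diff)
  then show ?thesis by (simp add: slope_def arctan_minus)
qed

lemma orbit_reflect:
  assumes "orbit a \<gamma> E \<mu> y" shows "orbit a (- \<gamma>) E \<mu> (\<lambda>s. - pi - y (- s))"
  unfolding orbit_def
proof
  fix s
  have "((\<lambda>s. y (- s)) has_real_derivative - slope a \<gamma> E \<mu> (- s) (y (- s))) (at s)"
    using orbitD[OF assms, of "- s"] by (simp add: DERIV_mirror)
  then have "((\<lambda>s. - pi - y (- s)) has_real_derivative slope a \<gamma> E \<mu> (- s) (y (- s))) (at s)"
    by (auto intro!: derivative_eq_intros)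
  then show "((\<lambda>s. - pi - y (- s)) has_real_derivative slope a (- \<gamma>) E \<mu> s (- pi - y (- s))) (at s)"
    using slope_reflect[of a \<gamma> E \<mu> s "- pi - y (- s)"] by simp
qed

lemma unstable_imp_stable_reflect:
  assumes "unstable_orbit a \<gamma> E \<mu> y" shows "stable_orbit a (- \<gamma>) E \<mu> (\<lambda>s. - pi - y (- s))"
proof -
  have "((\<lambda>s. y (- s)) \<longlongrightarrow> - pi + arccos E) at_top"
    using assms by (simp add: unstable_orbit_def filterlim_at_bot_mirror)
  from tendsto_diff[OF tendsto_const[of "- pi"] this] show ?thesis
    using assms by (simp add: unstable_orbit_def stable_orbit_def orbit_reflect)
qed

lemma stable_imp_unstable_reflect:
  assumes "stable_orbit a \<gamma> E \<mu> y" shows "unstable_orbit a (- \<gamma>) E \<mu> (\<lambda>s. - pi - y (- s))"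
proof -
  have "((\<lambda>s. y (- s)) \<longlongrightarrow> - arccos E) at_bot"
    using assms by (simp add: stable_orbit_def filterlim_at_top_mirror)
  from tendsto_diff[OF tendsto_const[of "- pi"] this] show ?thesis
    using assms by (simp add: unstable_orbit_def stable_orbit_def orbit_reflect)
qed

text \<open>The divided difference of \<open>slope\<close> in \<open>y\<close>, in the form of the product-to-sum formulas so that it
  is visibly continuous across the diagonal.\<close>

definition slope_quot :: "real \<Rightarrow> real \<Rightarrow> real \<Rightarrow> real \<Rightarrow> real \<Rightarrow> real" where
  "slope_quot a \<mu> s x y = sinc ((y - x) / 2) *
     (- 2 * a * sin (arctan s) * sin ((x + y) / 2) + 2 * \<mu> * cos (arctan s) * cos ((x + y) / 2))"

lemma slope_diff: "slope a \<gamma> E \<mu> s y - slope a \<gamma> E \<mu> s x = slope_quot a \<mu> s x y * (y - x)"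
proof -
  have d: "sinc ((y - x) / 2) * (y - x) = 2 * sin ((y - x) / 2)" by simp
  have c: "cos y - cos x = - (sin ((x + y) / 2) * (sinc ((y - x) / 2) * (y - x)))"
    unfolding d cos_diff_cos[of y x] minus_divide_left[symmetric]
    using sin_minus[of "(y - x) / 2"] by (simp add: add.commute minus_divide_left)
  have s: "sin y - sin x = cos ((x + y) / 2) * (sinc ((y - x) / 2) * (y - x))"
    unfolding d sin_diff_sin[of y x] by (simp add: add.commute)
  have "slope a \<gamma> E \<mu> s y - slope a \<gamma> E \<mu> s x =
     2 * a * sin (arctan s) * (cos y - cos x) + 2 * \<mu> * cos (arctan s) * (sin y - sin x)"
    by (simp add: slope_def algebra_simps)
  then show ?thesis unfolding c s by (simp add: slope_quot_def algebra_simps)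
qed

lemma slope_diff_params:
  "slope a \<gamma> E2 \<mu>2 s y - slope a \<gamma> E1 \<mu>1 s y =
     2 * (\<mu>2 - \<mu>1) * cos (arctan s) * sin y - 2 * a * (E2 - E1)"
  by (simp add: slope_def algebra_simps)

text \<open>Reversing time flips the sign: forward repulsion at the right saddle becomes forward
  attraction at the left one, with the same kind of rate bound.\<close>

lemma slope_quot_reflect: "slope_quot a \<mu> (- s) (- pi - x) (- pi - y) = - slope_quot a \<mu> s x y"
proof -
  have m: "(- pi - x + (- pi - y)) / 2 = - pi - (x + y) / 2" by (simp add: field_simps)
  have d: "(- pi - y - (- pi - x)) / 2 = - ((y - x) / 2)" by (simp add: field_simps)
  have "cos (- pi - z) = - cos z" "sin (- pi - z) = sin z" for z :: real
    by (simp_all add: cos_diff sin_diff)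
  then show ?thesis
    unfolding slope_quot_def m d sinc_neg by (simp add: arctan_minus algebra_simps)
qed

lemma abs_sinc_le_1: "\<bar>sinc x\<bar> \<le> 1"
  using abs_sin_x_le_abs_x[of x] by (auto simp: field_simps)

lemma abs_mult_mult_le:
  fixes u v w :: real
  assumes "\<bar>v\<bar> \<le> 1" "\<bar>w\<bar> \<le> 1" shows "\<bar>u * v * w\<bar> \<le> \<bar>u\<bar>"
  using assms mult_left_le[of "\<bar>v\<bar> * \<bar>w\<bar>" "\<bar>u\<bar>"] by (simp add: abs_mult mult_le_one mult.assoc)

lemma abs_slope_quot_le: "\<bar>slope_quot a \<mu> s x y\<bar> \<le> 2 * \<bar>a\<bar> + 2 * \<bar>\<mu>\<bar>"
proof -
  have "\<bar>- 2 * a * sin (arctan s) * sin ((x + y) / 2)\<bar> \<le> 2 * \<bar>a\<bar>"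
    using abs_mult_mult_le[of "sin (arctan s)" "sin ((x + y) / 2)" "- 2 * a"] by (simp add: abs_mult)
  moreover have "\<bar>2 * \<mu> * cos (arctan s) * cos ((x + y) / 2)\<bar> \<le> 2 * \<bar>\<mu>\<bar>"
    using abs_mult_mult_le[of "cos (arctan s)" "cos ((x + y) / 2)" "2 * \<mu>"] by (simp add: abs_mult)
  ultimately have "\<bar>- 2 * a * sin (arctan s) * sin ((x + y) / 2) + 2 * \<mu> * cos (arctan s) * cos ((x + y) / 2)\<bar>
     \<le> 2 * \<bar>a\<bar> + 2 * \<bar>\<mu>\<bar>" by linarith
  moreover have "\<bar>sinc ((y - x) / 2)\<bar> \<le> 1" by (rule abs_sinc_le_1)
  ultimately show ?thesis
    unfolding slope_quot_def abs_mult
    by (meson abs_ge_zero mult_left_le_one_le order_trans)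
qed

lemma sin_arctan_tendsto: "((\<lambda>s. sin (arctan s)) \<longlongrightarrow> 1) at_top"
  using tendsto_sin[OF tendsto_arctan_at_top] by simp

lemma cos_arctan_tendsto: "((\<lambda>s. cos (arctan s)) \<longlongrightarrow> 0) at_top"
  using tendsto_cos[OF tendsto_arctan_at_top] by simp

lemma cos_arctan_gt_0: "0 < cos (arctan s)"
  using arctan_bounded[of s] by (intro cos_gt_zero_pi) auto

lemma orbit_exists:
  obtains y where "y s0 = y0" "orbit a \<gamma> E \<mu> y"
proof -
  let ?B = "2 * \<bar>a\<bar> + 2 * \<bar>\<mu>\<bar> + 2 * \<bar>\<gamma>\<bar> + 1 + 2 * \<bar>a * E\<bar>"
  have bd: "\<bar>slope a \<gamma> E \<mu> s y\<bar> \<le> ?B" for s y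
  proof -
    have sum: "\<bar>A + B + C + D - G\<bar> \<le> p + q + r + t + u"
      if "\<bar>A\<bar> \<le> p" "\<bar>B\<bar> \<le> q" "\<bar>C\<bar> \<le> r" "\<bar>D\<bar> \<le> t" "\<bar>G\<bar> \<le> u" for A B C D G p q r t u :: real
      using that unfolding abs_le_iff by linarith
    have "\<bar>2 * a * sin (arctan s) * cos y\<bar> \<le> 2 * \<bar>a\<bar>"
      "\<bar>2 * \<mu> * cos (arctan s) * sin y\<bar> \<le> 2 * \<bar>\<mu>\<bar>"
      "\<bar>2 * \<gamma> * sin (arctan s) * cos (arctan s)\<bar> \<le> 2 * \<bar>\<gamma>\<bar>"
      using abs_mult_mult_le[of "sin (arctan s)" "cos y" "2 * a"] abs_mult_mult_le[of "cos (arctan s)" "sin y" "2 * \<mu>"]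
        abs_mult_mult_le[of "sin (arctan s)" "cos (arctan s)" "2 * \<gamma>"] by (simp_all add: abs_mult)
    moreover have "\<bar>(cos (arctan s))\<^sup>2\<bar> \<le> 1" by (simp add: abs_square_le_1)
    moreover have "\<bar>2 * a * E\<bar> \<le> 2 * \<bar>a * E\<bar>" by (simp add: abs_mult)
    ultimately show ?thesis unfolding slope_def by (rule sum)
  qed
  \<comment> \<open>The summand 1 keeps the Lipschitz constant positive even if \<open>a\<close> and
    \<open>\<mu>\<close> vanish.\<close>
  have lip: "\<bar>slope a \<gamma> E \<mu> s x - slope a \<gamma> E \<mu> s y\<bar> \<le> (2 * \<bar>a\<bar> + 2 * \<bar>\<mu>\<bar> + 1) * \<bar>x - y\<bar>" for s x y
    unfolding slope_diff abs_mult using abs_slope_quot_le[of a \<mu> s y x] by (intro mult_right_mono) auto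
  have cont: "continuous_on UNIV (\<lambda>p. slope a \<gamma> E \<mu> (fst p) (snd p))"
    unfolding slope_def by (intro continuous_intros)
  show ?thesis
    by (rule Lipschitz_ode_solution[OF cont bd lip, of s0 y0]) (auto simp: orbit_def intro: that)
qed

text \<open>The change of \<open>y\<close> is made first, at the parameters \<open>E1\<close> and
  \<open>\<mu>1\<close>, and the change of parameters second, at the point \<open>y2\<close>. That
  is why the coefficient carries \<open>\<mu>1\<close> while the forcing carries
  \<open>sin (y2 s)\<close>.\<close>

lemma orbit_diff_deriv:
  assumes "orbit a \<gamma> E1 \<mu>1 y1" "orbit a \<gamma> E2 \<mu>2 y2"
  shows "((\<lambda>s. y2 s - y1 s) has_real_derivative slope_quot a \<mu>1 s (y1 s) (y2 s) * (y2 s - y1 s)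
     + (2 * (\<mu>2 - \<mu>1) * cos (arctan s) * sin (y2 s) - 2 * a * (E2 - E1))) (at s)"
proof -
  have "((\<lambda>s. y2 s - y1 s) has_real_derivative
      slope a \<gamma> E2 \<mu>2 s (y2 s) - slope a \<gamma> E1 \<mu>1 s (y1 s)) (at s)"
    by (intro derivative_intros orbitD assms)
  then show ?thesis
    unfolding slope_diff[of a \<gamma> E1 \<mu>1 s "y2 s" "y1 s", symmetric]
      slope_diff_params[of a \<gamma> E2 \<mu>2 s "y2 s" E1 \<mu>1, symmetric]
    by simp
qed

lemma orbit_forcing_le:
  "\<bar>2 * (\<mu>2 - \<mu>1) * cos (arctan s) * sin y - 2 * a * (E2 - E1)\<bar>
     \<le> 2 * \<bar>\<mu>2 - \<mu>1\<bar> + 2 * \<bar>a\<bar> * \<bar>E2 - E1\<bar>"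
proof -
  have "\<bar>2 * a * (E2 - E1)\<bar> = 2 * \<bar>a\<bar> * \<bar>E2 - E1\<bar>" by (simp add: abs_mult)
  moreover have "\<bar>2 * (\<mu>2 - \<mu>1) * cos (arctan s) * sin y\<bar> \<le> \<bar>2 * (\<mu>2 - \<mu>1)\<bar>"
    by (rule abs_mult_mult_le) auto
  ultimately show ?thesis
    using abs_triangle_ineq4[of "2 * (\<mu>2 - \<mu>1) * cos (arctan s) * sin y" "2 * a * (E2 - E1)"]
    by (simp only: abs_mult abs_numeral)
qed

lemma orbit_Gronwall:
  fixes a E1 E2 \<mu>1 \<mu>2 :: real
  defines "r \<equiv> 2 * \<bar>\<mu>2 - \<mu>1\<bar> + 2 * \<bar>a\<bar> * \<bar>E2 - E1\<bar>"
  assumes "orbit a \<gamma> E1 \<mu>1 y1" "orbit a \<gamma> E2 \<mu>2 y2"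
  shows "(y2 s - y1 s)\<^sup>2 \<le> exp ((2 * (2 * \<bar>a\<bar> + 2 * \<bar>\<mu>1\<bar>) + 1) * \<bar>s - t\<bar>) * ((y2 t - y1 t)\<^sup>2 + r\<^sup>2)"
proof -
  let ?f = "\<lambda>s. 2 * (\<mu>2 - \<mu>1) * cos (arctan s) * sin (y2 s) - 2 * a * (E2 - E1)"
  have "\<bar>slope_quot a \<mu>1 s (y1 s) (y2 s) * (y2 s - y1 s) + ?f s\<bar>
      \<le> (2 * \<bar>a\<bar> + 2 * \<bar>\<mu>1\<bar>) * \<bar>y2 s - y1 s\<bar> + r" for s
  proof -
    have "\<bar>slope_quot a \<mu>1 s (y1 s) (y2 s) * (y2 s - y1 s)\<bar> \<le> (2 * \<bar>a\<bar> + 2 * \<bar>\<mu>1\<bar>) * \<bar>y2 s - y1 s\<bar>"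
      unfolding abs_mult by (intro mult_right_mono abs_slope_quot_le) auto
    from abs_triangle_ineq[THEN order_trans, OF add_mono[OF this orbit_forcing_le[of \<mu>2 \<mu>1 s "y2 s" a E2 E1]]]
    show ?thesis unfolding r_def .
  qed
  from square_Gronwall[OF orbit_diff_deriv[OF assms(2,3)] this, of s t]
  have "(y2 s - y1 s)\<^sup>2 + r\<^sup>2 \<le> exp ((2 * (2 * \<bar>a\<bar> + 2 * \<bar>\<mu>1\<bar>) + 1) * \<bar>s - t\<bar>) * ((y2 t - y1 t)\<^sup>2 + r\<^sup>2)"
    by simp
  then show ?thesis by (smt (verit) zero_le_power2)
qed

lemma orbit_unique:
  assumes "orbit a \<gamma> E \<mu> y1" "orbit a \<gamma> E \<mu> y2" "y1 t = y2 t"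
  shows "y1 = y2"
  using orbit_Gronwall[OF assms(1,2), of _ t] assms(3) by fastforce

lemma orbit_tendsto:
  assumes y: "\<And>n. orbit a \<gamma> (E n) (\<mu> n) (y n)" "orbit a \<gamma> E0 \<mu>0 y0"
    and "E \<longlonglongrightarrow> E0" "\<mu> \<longlonglongrightarrow> \<mu>0" and t: "(\<lambda>n. y n t) \<longlonglongrightarrow> y0 t"
  shows "(\<lambda>n. y n s) \<longlonglongrightarrow> y0 s"
proof -
  \<comment> \<open>The limit orbit is taken as the first orbit in \<open>orbit_Gronwall\<close>, so
    this constant involves \<open>\<mu>0\<close> only and does not vary with
    \<open>n\<close>.\<close>
  let ?K = "exp ((2 * (2 * \<bar>a\<bar> + 2 * \<bar>\<mu>0\<bar>) + 1) * \<bar>s - t\<bar>)"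
  have "(\<lambda>n. ?K * ((y n t - y0 t)\<^sup>2 + (2 * \<bar>\<mu> n - \<mu>0\<bar> + 2 * \<bar>a\<bar> * \<bar>E n - E0\<bar>)\<^sup>2))
      \<longlonglongrightarrow> ?K * ((y0 t - y0 t)\<^sup>2 + (2 * \<bar>\<mu>0 - \<mu>0\<bar> + 2 * \<bar>a\<bar> * \<bar>E0 - E0\<bar>)\<^sup>2)"
    by (intro tendsto_intros assms)
  then have "(\<lambda>n. ?K * ((y n t - y0 t)\<^sup>2 + (2 * \<bar>\<mu> n - \<mu>0\<bar> + 2 * \<bar>a\<bar> * \<bar>E n - E0\<bar>)\<^sup>2)) \<longlonglongrightarrow> 0"
    by simp
  then have "(\<lambda>n. (y n s - y0 s)\<^sup>2) \<longlonglongrightarrow> 0"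
    by (rule tendsto_sandwich[OF _ _ tendsto_const, rotated 2])
       (use orbit_Gronwall[OF y(2,1)] in auto)
  then have "(\<lambda>n. sqrt ((y n s - y0 s)\<^sup>2)) \<longlonglongrightarrow> 0" using tendsto_real_sqrt by fastforce
  then have "(\<lambda>n. y n s - y0 s) \<longlonglongrightarrow> 0" by (simp add: tendsto_rabs_zero_iff)
  then show ?thesis by (simp add: LIM_zero_iff)
qed

section \<open>Orbits near the saddle\<close>

lemma orbit_stays_above:
  assumes "orbit a \<gamma> E \<mu> y" "c \<le> y p" "p < q"
    and "\<And>s. p \<le> s \<Longrightarrow> s \<le> q \<Longrightarrow> 0 < slope a \<gamma> E \<mu> s c"
  shows "c < y q"
proof -
  have "((\<lambda>s. y s - c) has_real_derivative slope a \<gamma> E \<mu> t (y t)) (at t)" for t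
    by (auto intro!: derivative_eq_intros orbitD[OF assms(1)])
  then have "0 < y q - c"
    by (rule strict_mono_barrier[where p=p]) (use assms in auto)
  then show ?thesis by simp
qed

lemma orbit_stays_below:
  assumes "orbit a \<gamma> E \<mu> y" "y p \<le> c" "p < q"
    and "\<And>s. p \<le> s \<Longrightarrow> s \<le> q \<Longrightarrow> slope a \<gamma> E \<mu> s c < 0"
  shows "y q < c"
proof -
  have "((\<lambda>s. c - y s) has_real_derivative - slope a \<gamma> E \<mu> t (y t)) (at t)" for t
    by (auto intro!: derivative_eq_intros orbitD[OF assms(1)])
  then have "0 < c - y q"
    by (rule strict_mono_barrier[where p=p]) (use assms in auto)
  then show ?thesis by simp
qed

text \<open>As \<open>s\<close> grows only \<open>2 * a * (cos y - E)\<close> survives. The error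
  bound depends neither on \<open>E\<close> nor on \<open>y\<close>, and on \<open>\<mu>\<close>
  only through \<open>M\<close>, so the times chosen from it are uniform in the parameters.\<close>

lemma slope_asymp:
  assumes "\<bar>\<mu>\<bar> \<le> M"
  shows "\<bar>slope a \<gamma> E \<mu> s y - 2 * a * (sin (arctan s) * cos y - E)\<bar>
    \<le> (2 * M + 2 * \<bar>\<gamma>\<bar> + 1) * cos (arctan s)"
proof -
  have c: "0 \<le> cos (arctan s)" using cos_arctan_gt_0[of s] by simp
  have sum: "\<bar>A + B + C\<bar> \<le> p + q + r"
      if "\<bar>A\<bar> \<le> p" "\<bar>B\<bar> \<le> q" "\<bar>C\<bar> \<le> r" for A B C p q r :: real
    using that unfolding abs_le_iff by linarith
  have "\<bar>2 * \<mu> * sin y\<bar> \<le> 2 * M"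
    using assms by (simp add: abs_mult mult_le_one) (smt (verit) abs_sin_le_one mult_left_le abs_ge_zero)
  moreover have "\<bar>2 * \<gamma> * sin (arctan s)\<bar> \<le> 2 * \<bar>\<gamma>\<bar>"
    by (simp only: abs_mult abs_numeral) (simp add: mult_left_le)
  moreover have "\<bar>cos (arctan s)\<bar> \<le> 1" by simp
  ultimately have "\<bar>2 * \<mu> * sin y + 2 * \<gamma> * sin (arctan s) + cos (arctan s)\<bar> \<le> 2 * M + 2 * \<bar>\<gamma>\<bar> + 1"
    by (rule sum)
  then have "\<bar>2 * \<mu> * sin y + 2 * \<gamma> * sin (arctan s) + cos (arctan s)\<bar> * cos (arctan s)
     \<le> (2 * M + 2 * \<bar>\<gamma>\<bar> + 1) * cos (arctan s)" using c by (intro mult_right_mono)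
  moreover have "\<bar>slope a \<gamma> E \<mu> s y - 2 * a * (sin (arctan s) * cos y - E)\<bar>
      = \<bar>2 * \<mu> * sin y + 2 * \<gamma> * sin (arctan s) + cos (arctan s)\<bar> * cos (arctan s)"
  proof -
    have "slope a \<gamma> E \<mu> s y - 2 * a * (sin (arctan s) * cos y - E)
      = (2 * \<mu> * sin y + 2 * \<gamma> * sin (arctan s) + cos (arctan s)) * cos (arctan s)"
      by (simp add: slope_def algebra_simps power2_eq_square)
    then show ?thesis using c by (simp only: abs_mult abs_of_nonneg)
  qed
  ultimately show ?thesis by simp
qed

text \<open>Backwards in time, the lines \<open>y = q \<plusminus> \<epsilon>\<close> around the saddle \<open>q = - arccos E0\<close> can only be crossed
  inwards.\<close>

lemma orbit_tail:
  fixes a \<gamma> E0 \<epsilon> M :: real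
  defines "q \<equiv> - arccos E0"
  assumes a: "0 < a" and E0: "-1 < E0" "E0 < 1" and eps: "0 < \<epsilon>" "q + \<epsilon> < 0" "- pi < q - \<epsilon>"
  shows "\<exists>S \<delta>. 0 < \<delta> \<and> (\<forall>E \<mu> y T s. \<bar>E - E0\<bar> < \<delta> \<longrightarrow> \<bar>\<mu>\<bar> \<le> M \<longrightarrow> orbit a \<gamma> E \<mu> y \<longrightarrow>
           \<bar>y T - q\<bar> < \<epsilon> \<longrightarrow> S \<le> s \<longrightarrow> s \<le> T \<longrightarrow> \<bar>y s - q\<bar> < \<epsilon>)"
proof -
  have cq: "cos q = E0" using E0 by (simp add: q_def)
  have up: "E0 < cos (q + \<epsilon>)" and dn: "cos (q - \<epsilon>) < E0"
    using cos_monotone_minus_pi_0[of q "q + \<epsilon>"] cos_monotone_minus_pi_0[of "q - \<epsilon>" q] eps cq by auto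
  \<comment> \<open>With half of the smaller gap, every \<open>E\<close> within
    \<open>\<delta>\<close> of \<open>E0\<close> leaves the limiting slope strictly positive on the
    upper line and strictly negative on the lower one.\<close>
  define \<delta> where "\<delta> = min (cos (q + \<epsilon>) - E0) (E0 - cos (q - \<epsilon>)) / 2"
  have \<delta>: "0 < \<delta>" "E0 + \<delta> < cos (q + \<epsilon>)" "cos (q - \<epsilon>) < E0 - \<delta>"
    using up dn by (auto simp: \<delta>_def min_def field_simps)
  define K where "K = 2 * M + 2 * \<bar>\<gamma>\<bar> + 1"
  have "((\<lambda>s. 2 * a * (sin (arctan s) * cos (q + \<epsilon>) - (E0 + \<delta>)) - K * cos (arctan s))
      \<longlongrightarrow> 2 * a * (1 * cos (q + \<epsilon>) - (E0 + \<delta>)) - K * 0) at_top"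
    by (intro tendsto_intros sin_arctan_tendsto cos_arctan_tendsto)
  moreover have "0 < 2 * a * (1 * cos (q + \<epsilon>) - (E0 + \<delta>)) - K * 0" using a \<delta> by simp
  ultimately have e1: "\<forall>\<^sub>F s in at_top. 0 < 2 * a * (sin (arctan s) * cos (q + \<epsilon>) - (E0 + \<delta>)) - K * cos (arctan s)"
    by (rule order_tendstoD)
  have "((\<lambda>s. 2 * a * (sin (arctan s) * cos (q - \<epsilon>) - (E0 - \<delta>)) + K * cos (arctan s))
      \<longlongrightarrow> 2 * a * (1 * cos (q - \<epsilon>) - (E0 - \<delta>)) + K * 0) at_top"
    by (intro tendsto_intros sin_arctan_tendsto cos_arctan_tendsto)
  moreover have "2 * a * (1 * cos (q - \<epsilon>) - (E0 - \<delta>)) + K * 0 < 0"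
    using a \<delta> by (simp add: mult_less_0_iff)
  ultimately have e2: "\<forall>\<^sub>F s in at_top. 2 * a * (sin (arctan s) * cos (q - \<epsilon>) - (E0 - \<delta>)) + K * cos (arctan s) < 0"
    by (rule order_tendstoD)
  from eventually_conj[OF e1 e2] obtain S where S:
     "\<And>s. S \<le> s \<Longrightarrow> 0 < 2 * a * (sin (arctan s) * cos (q + \<epsilon>) - (E0 + \<delta>)) - K * cos (arctan s)"
     "\<And>s. S \<le> s \<Longrightarrow> 2 * a * (sin (arctan s) * cos (q - \<epsilon>) - (E0 - \<delta>)) + K * cos (arctan s) < 0"
    by (auto simp: eventually_at_top_linorder)
  show ?thesis
  proof (intro exI conjI allI impI)
    fix E \<mu> y T s
    assume E: "\<bar>E - E0\<bar> < \<delta>" and \<mu>: "\<bar>\<mu>\<bar> \<le> M" and y: "orbit a \<gamma> E \<mu> y"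
      and T: "\<bar>y T - q\<bar> < \<epsilon>" and s: "S \<le> s" "s \<le> T"
    have Em: "a * E < a * (E0 + \<delta>)" "a * (E0 - \<delta>) < a * E" using E a by auto
    have pos: "0 < slope a \<gamma> E \<mu> t (q + \<epsilon>)" if "S \<le> t" for t
    proof -
      have "\<bar>slope a \<gamma> E \<mu> t (q + \<epsilon>) - 2 * a * (sin (arctan t) * cos (q + \<epsilon>) - E)\<bar> \<le> K * cos (arctan t)"
        unfolding K_def by (rule slope_asymp[OF \<mu>])
      then show ?thesis using S(1)[OF that] Em unfolding abs_le_iff by (simp add: right_diff_distrib)
    qed
    have neg: "slope a \<gamma> E \<mu> t (q - \<epsilon>) < 0" if "S \<le> t" for t
    proof -
      have "\<bar>slope a \<gamma> E \<mu> t (q - \<epsilon>) - 2 * a * (sin (arctan t) * cos (q - \<epsilon>) - E)\<bar> \<le> K * cos (arctan t)"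
        unfolding K_def by (rule slope_asymp[OF \<mu>])
      then show ?thesis using S(2)[OF that] Em unfolding abs_le_iff by (simp add: right_diff_distrib)
    qed
    show "\<bar>y s - q\<bar> < \<epsilon>"
    proof (cases "s = T")
      case True then show ?thesis using T by simp
    next
      case False
      then have "s < T" using s by simp
      have "y s < q + \<epsilon>"
      proof (rule ccontr)
        assume "\<not> ?thesis"
        then have "q + \<epsilon> < y T" by (intro orbit_stays_above[OF y _ \<open>s < T\<close>] pos) (use s in auto)
        then show False using T by linarith
      qed
      moreover have "q - \<epsilon> < y s"
      proof (rule ccontr)
        assume "\<not> ?thesis"
        then have "y T < q - \<epsilon>" by (intro orbit_stays_below[OF y _ \<open>s < T\<close>] neg) (use s in auto)
        then show False using T by linarith
      qed
      ultimately show ?thesis by linarith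
    qed
  qed (rule \<delta>)
qed

text \<open>The strip around \<open>- arccos E0\<close> has to stay inside \<open>(- pi, 0)\<close>,
  where \<open>cos\<close> is strictly increasing, before \<open>orbit_tail\<close> applies.\<close>

lemma shrink_radius:
  fixes E0 e :: real
  assumes "-1 < E0" "E0 < 1" "0 < e"
  obtains \<epsilon> where "0 < \<epsilon>" "\<epsilon> \<le> e" "- arccos E0 + \<epsilon> < 0" "- pi < - arccos E0 - \<epsilon>"
proof -
  have b: "0 < arccos E0" "arccos E0 < pi" using arccos_lt_bounded[of E0] assms by auto
  define \<epsilon> where "\<epsilon> = min e (min (arccos E0 / 2) ((pi - arccos E0) / 2))"
  have eps: "0 < \<epsilon>" unfolding \<epsilon>_def min_less_iff_conj using b assms by simp
  have eps2: "\<epsilon> \<le> e" "\<epsilon> \<le> arccos E0 / 2" "\<epsilon> \<le> (pi - arccos E0) / 2"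
    unfolding \<epsilon>_def
    by (rule min.cobounded1 min.coboundedI2[OF min.cobounded1] min.coboundedI2[OF min.cobounded2])+
  have "- arccos E0 + \<epsilon> < 0" using eps2(2) b by linarith
  moreover have "- pi < - arccos E0 - \<epsilon>" using eps2(3) b(2) by (simp add: field_simps)
  ultimately show ?thesis using that eps eps2(1) by blast
qed

text \<open>Convergence puts each orbit inside the strip at some late time \<open>T\<close>, and
  \<open>orbit_tail\<close> carries this back to a time \<open>S\<close> that does not depend on the
  orbit. So pointwise convergence to the saddle becomes uniform over nearby parameters.\<close>

lemma stable_tail:
  assumes a: "0 < a" and E0: "-1 < E0" "E0 < 1" and "0 < e"
  shows "\<exists>S \<delta>. 0 < \<delta> \<and> (\<forall>E \<mu> y s. \<bar>E - E0\<bar> < \<delta> \<longrightarrow> \<bar>\<mu>\<bar> \<le> M \<longrightarrow> stable_orbit a \<gamma> E \<mu> y \<longrightarrow>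
           S \<le> s \<longrightarrow> \<bar>y s + arccos E0\<bar> < e)"
proof -
  obtain \<epsilon> where eps: "0 < \<epsilon>" "\<epsilon> \<le> e" "- arccos E0 + \<epsilon> < 0" "- pi < - arccos E0 - \<epsilon>"
    using shrink_radius[OF E0 \<open>0 < e\<close>] by blast
  obtain S \<delta> where S: "0 < \<delta>" "\<And>E \<mu> y T s. \<bar>E - E0\<bar> < \<delta> \<Longrightarrow> \<bar>\<mu>\<bar> \<le> M \<Longrightarrow> orbit a \<gamma> E \<mu> y \<Longrightarrow>
           \<bar>y T - - arccos E0\<bar> < \<epsilon> \<Longrightarrow> S \<le> s \<Longrightarrow> s \<le> T \<Longrightarrow> \<bar>y s - - arccos E0\<bar> < \<epsilon>"
    using orbit_tail[OF a E0 eps(1,3,4), of M \<gamma>] by metis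
  \<comment> \<open>The orbits tend to \<open>- arccos E\<close>, but the strip is centred at
    \<open>- arccos E0\<close>; for \<open>E\<close> close to \<open>E0\<close> the limit still lies
    inside.\<close>
  have "isCont arccos E0" using E0 by (rule isCont_arccos)
  then obtain \<delta>2 where d2: "0 < \<delta>2" "\<And>E. \<bar>E - E0\<bar> < \<delta>2 \<Longrightarrow> \<bar>arccos E - arccos E0\<bar> < \<epsilon>"
    using eps(1) unfolding isCont_def LIM_def dist_real_def by (metis diff_self abs_zero)
  show ?thesis
  proof (rule exI[of _ S], rule exI[of _ "min \<delta> \<delta>2"], intro conjI allI impI)
    fix E \<mu> y s
    assume E: "\<bar>E - E0\<bar> < min \<delta> \<delta>2" and \<mu>: "\<bar>\<mu>\<bar> \<le> M" and y: "stable_orbit a \<gamma> E \<mu> y" and s: "S \<le> s"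
    have lim: "((\<lambda>T. \<bar>y T - - arccos E0\<bar>) \<longlongrightarrow> \<bar>- arccos E - - arccos E0\<bar>) at_top"
      using y by (intro tendsto_intros) (simp add: stable_orbit_def)
    have "\<forall>\<^sub>F T in at_top. \<bar>y T - - arccos E0\<bar> < \<epsilon>"
      by (rule order_tendstoD(2)[OF lim]) (use d2(2)[of E] E in \<open>simp add: abs_minus_commute\<close>)
    with eventually_ge_at_top[of s] have "\<forall>\<^sub>F T in at_top. s \<le> T \<and> \<bar>y T - - arccos E0\<bar> < \<epsilon>"
      by (rule eventually_conj)
    from eventually_happens[OF this] obtain T where "s \<le> T" "\<bar>y T - - arccos E0\<bar> < \<epsilon>" by auto
    then have "\<bar>y s - - arccos E0\<bar> < \<epsilon>"
      using S(2)[of E \<mu> y T s] E \<mu> y s by (simp add: stable_orbit_def)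
    then show "\<bar>y s + arccos E0\<bar> < e" using eps by simp
  qed (use S d2 in auto)
qed

text \<open>This is the hyperbolicity of the right saddle. There the quotient tends to
  \<open>2 * a * sin (arccos E0) > 0\<close>, and its continuity across the diagonal keeps it
  positive for two different points near the saddle. From the limit \<open>p\<close>, one half is
  given up to this continuity and a further quarter to the terms that vanish as \<open>s\<close>
  grows, hence the rate \<open>p / 4\<close>.\<close>

lemma slope_quot_lower:
  fixes a E0 M :: real
  assumes a: "0 < a" and E0: "-1 < E0" "E0 < 1"
  shows "\<exists>\<kappa> \<epsilon> S. 0 < \<kappa> \<and> 0 < \<epsilon> \<and> (\<forall>\<mu> s x y. \<bar>\<mu>\<bar> \<le> M \<longrightarrow> S \<le> s \<longrightarrow>
     \<bar>x + arccos E0\<bar> < \<epsilon> \<longrightarrow> \<bar>y + arccos E0\<bar> < \<epsilon> \<longrightarrow> \<kappa> \<le> slope_quot a \<mu> s x y)"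
proof -
  define q where "q = - arccos E0"
  define h where "h = (\<lambda>p::real \<times> real. sinc ((snd p - fst p) / 2) * (- 2 * a * sin ((fst p + snd p) / 2)))"
  define p where "p = h (q, q)"
  have "0 < arccos E0" "arccos E0 < pi" using arccos_lt_bounded[of E0] E0 by auto
  then have p: "0 < p" using a by (simp add: p_def h_def q_def sin_gt_zero)
  have "continuous_on UNIV h" unfolding h_def by (intro continuous_intros) auto
  then have "isCont h (q, q)" by (simp add: continuous_on_eq_continuous_at)
  then obtain d where d: "0 < d" "\<And>z. dist z (q, q) < d \<Longrightarrow> dist (h z) p < p / 2"
    unfolding continuous_at_eps_delta p_def using p unfolding p_def by (meson half_gt_zero)
  have h: "p / 2 \<le> h (x, y)" if "\<bar>x - q\<bar> < d / 2" "\<bar>y - q\<bar> < d / 2" for x y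
  proof -
    have "dist (x, y) (q, q) \<le> \<bar>x - q\<bar> + \<bar>y - q\<bar>"
      unfolding dist_Pair_Pair dist_real_def using sqrt_sum_squares_le_sum_abs[of "x - q" "y - q"] by simp
    then have "dist (h (x, y)) p < p / 2" using that by (intro d) linarith
    then show ?thesis unfolding dist_real_def by linarith
  qed
  have "((\<lambda>s. sin (arctan s) * (p / 2) - 2 * M * cos (arctan s)) \<longlongrightarrow> 1 * (p / 2) - 2 * M * 0) at_top"
    by (intro tendsto_intros sin_arctan_tendsto cos_arctan_tendsto)
  then have "\<forall>\<^sub>F s in at_top. p / 4 < sin (arctan s) * (p / 2) - 2 * M * cos (arctan s)"
    by (rule order_tendstoD) (use p in simp)
  moreover have "\<forall>\<^sub>F s in at_top. 0 < sin (arctan s)"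
    by (rule order_tendstoD[OF sin_arctan_tendsto]) simp
  ultimately have "\<forall>\<^sub>F s in at_top. p / 4 < sin (arctan s) * (p / 2) - 2 * M * cos (arctan s) \<and> 0 < sin (arctan s)"
    by (rule eventually_conj)
  then obtain S where S: "\<And>s. S \<le> s \<Longrightarrow> p / 4 < sin (arctan s) * (p / 2) - 2 * M * cos (arctan s)"
      "\<And>s. S \<le> s \<Longrightarrow> 0 < sin (arctan s)"
    by (auto simp: eventually_at_top_linorder)
  have "p / 4 \<le> slope_quot a \<mu> s x y"
    if \<mu>: "\<bar>\<mu>\<bar> \<le> M" and s: "S \<le> s" and xy: "\<bar>x + arccos E0\<bar> < d / 2" "\<bar>y + arccos E0\<bar> < d / 2" for \<mu> s x y
  proof -
    have eq: "slope_quot a \<mu> s x y = sin (arctan s) * h (x, y)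
        + (2 * \<mu> * cos (arctan s)) * sinc ((y - x) / 2) * cos ((x + y) / 2)"
      unfolding slope_quot_def h_def fst_conv snd_conv distrib_left by (simp only: mult_ac)
    have 1: "sin (arctan s) * (p / 2) \<le> sin (arctan s) * h (x, y)"
      using S(2)[OF s] h[of x y] xy by (intro mult_left_mono) (auto simp: q_def)
    have "\<bar>(2 * \<mu> * cos (arctan s)) * sinc ((y - x) / 2) * cos ((x + y) / 2)\<bar> \<le> \<bar>2 * \<mu> * cos (arctan s)\<bar>"
      by (rule abs_mult_mult_le[OF abs_sinc_le_1]) simp
    also have "\<dots> = 2 * \<bar>\<mu>\<bar> * cos (arctan s)" using cos_arctan_gt_0[of s] by (simp add: abs_mult)
    also have "\<dots> \<le> 2 * M * cos (arctan s)" using \<mu> cos_arctan_gt_0[of s] by (intro mult_right_mono) auto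
    finally have 2: "- (2 * M * cos (arctan s)) \<le> (2 * \<mu> * cos (arctan s)) * sinc ((y - x) / 2) * cos ((x + y) / 2)"
      unfolding abs_le_iff by linarith
    show ?thesis unfolding eq using S(1)[OF s] 1 2 by linarith
  qed
  then show ?thesis using p d(1) by (intro exI[of _ "p/4"] exI[of _ "d/2"] exI[of _ S]) auto
qed

lemma stable_slope_quot_lower:
  fixes a \<gamma> E0 M :: real
  assumes a: "0 < a" and E0: "-1 < E0" "E0 < 1"
  shows "\<exists>\<kappa> S \<delta>. 0 < \<kappa> \<and> 0 < \<delta> \<and> (\<forall>E1 E2 \<mu>1 \<mu>2 y1 y2 s. \<bar>E1 - E0\<bar> < \<delta> \<longrightarrow> \<bar>E2 - E0\<bar> < \<delta> \<longrightarrow>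
     \<bar>\<mu>1\<bar> \<le> M \<longrightarrow> \<bar>\<mu>2\<bar> \<le> M \<longrightarrow> stable_orbit a \<gamma> E1 \<mu>1 y1 \<longrightarrow> stable_orbit a \<gamma> E2 \<mu>2 y2 \<longrightarrow> S \<le> s \<longrightarrow>
     \<kappa> \<le> slope_quot a \<mu>1 s (y1 s) (y2 s) \<and> \<bar>y2 s - y1 s\<bar> \<le> 1)"
proof -
  obtain \<kappa> \<epsilon> S1 where k: "0 < \<kappa>" "0 < \<epsilon>" "\<And>\<mu> s x y. \<bar>\<mu>\<bar> \<le> M \<Longrightarrow> S1 \<le> s \<Longrightarrow>
     \<bar>x + arccos E0\<bar> < \<epsilon> \<Longrightarrow> \<bar>y + arccos E0\<bar> < \<epsilon> \<Longrightarrow> \<kappa> \<le> slope_quot a \<mu> s x y"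
    using slope_quot_lower[OF a E0, of M] by metis
  \<comment> \<open>Two orbits within \<open>1/2\<close> of the saddle differ by at most 1, which is
    the a priori bound that the repulsion argument needs.\<close>
  have "0 < min \<epsilon> (1/2)" using k by simp
  from stable_tail[OF a E0 this, of M \<gamma>] obtain S2 \<delta> where S2: "0 < \<delta>"
    "\<And>E \<mu> y s. \<bar>E - E0\<bar> < \<delta> \<Longrightarrow> \<bar>\<mu>\<bar> \<le> M \<Longrightarrow> stable_orbit a \<gamma> E \<mu> y \<Longrightarrow>
           S2 \<le> s \<Longrightarrow> \<bar>y s + arccos E0\<bar> < min \<epsilon> (1/2)" by metis
  show ?thesis
  proof (rule exI[of _ \<kappa>], rule exI[of _ "max S1 S2"], rule exI[of _ \<delta>], intro conjI allI impI)
    fix E1 E2 \<mu>1 \<mu>2 y1 y2 s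
    assume H: "\<bar>E1 - E0\<bar> < \<delta>" "\<bar>E2 - E0\<bar> < \<delta>" "\<bar>\<mu>1\<bar> \<le> M" "\<bar>\<mu>2\<bar> \<le> M"
      "stable_orbit a \<gamma> E1 \<mu>1 y1" "stable_orbit a \<gamma> E2 \<mu>2 y2" "max S1 S2 \<le> s"
    have s: "S1 \<le> s" "S2 \<le> s" using H(7) by simp_all
    have c: "\<bar>y1 s + arccos E0\<bar> < \<epsilon>" "\<bar>y1 s + arccos E0\<bar> < 1/2"
      using S2(2)[OF H(1,3,5) s(2)] by simp_all
    have d: "\<bar>y2 s + arccos E0\<bar> < \<epsilon>" "\<bar>y2 s + arccos E0\<bar> < 1/2"
      using S2(2)[OF H(2,4,6) s(2)] by simp_all
    show "\<kappa> \<le> slope_quot a \<mu>1 s (y1 s) (y2 s)"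
      by (rule k(3)[OF H(3) s(1) c(1) d(1)])
    have "\<bar>y2 s - y1 s\<bar> = \<bar>(y2 s + arccos E0) - (y1 s + arccos E0)\<bar>" by simp
    also have "\<dots> \<le> \<bar>y2 s + arccos E0\<bar> + \<bar>y1 s + arccos E0\<bar>" by (rule abs_triangle_ineq4)
    also have "\<dots> \<le> 1" using c(2) d(2) by linarith
    finally show "\<bar>y2 s - y1 s\<bar> \<le> 1" .
  qed (use k S2 in auto)
qed

text \<open>No initial values are given to compare. Beyond \<open>S\<close> the difference is
  bounded and repelled, so \<open>bounded_repelled_bound\<close> makes it at most
  \<open>r n / \<kappa>\<close> at time \<open>S\<close>; Gronwall then transports this to any other
  time.\<close>

lemma stable_orbit_tendsto:
  assumes a: "0 < a" and E0: "-1 < E0" "E0 < 1"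
    and y: "\<And>n. stable_orbit a \<gamma> (E n) (\<mu> n) (y n)" "stable_orbit a \<gamma> E0 \<mu>0 y0"
    and lim: "E \<longlonglongrightarrow> E0" "\<mu> \<longlonglongrightarrow> \<mu>0"
  shows "(\<lambda>n. y n s) \<longlonglongrightarrow> y0 s"
proof -
  define M where "M = \<bar>\<mu>0\<bar> + 1"
  obtain \<kappa> S \<delta> where k: "0 < \<kappa>" "0 < \<delta>" "\<And>E1 E2 \<mu>1 \<mu>2 y1 y2 s. \<bar>E1 - E0\<bar> < \<delta> \<Longrightarrow> \<bar>E2 - E0\<bar> < \<delta> \<Longrightarrow>
     \<bar>\<mu>1\<bar> \<le> M \<Longrightarrow> \<bar>\<mu>2\<bar> \<le> M \<Longrightarrow> stable_orbit a \<gamma> E1 \<mu>1 y1 \<Longrightarrow> stable_orbit a \<gamma> E2 \<mu>2 y2 \<Longrightarrow> S \<le> s \<Longrightarrow>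
     \<kappa> \<le> slope_quot a \<mu>1 s (y1 s) (y2 s) \<and> \<bar>y2 s - y1 s\<bar> \<le> 1"
    using stable_slope_quot_lower[OF a E0, of M \<gamma>] by metis
  define r where "r = (\<lambda>n. 2 * \<bar>\<mu> n - \<mu>0\<bar> + 2 * \<bar>a\<bar> * \<bar>E n - E0\<bar>)"
  have "\<forall>\<^sub>F n in sequentially. \<bar>E n - E0\<bar> < \<delta>"
    using tendstoD[OF lim(1) k(2)] by (simp add: dist_real_def)
  moreover have "\<forall>\<^sub>F n in sequentially. \<bar>\<mu> n\<bar> < M"
    by (rule order_tendstoD[OF tendsto_rabs[OF lim(2)]]) (simp add: M_def)
  ultimately have "\<forall>\<^sub>F n in sequentially. \<bar>y n S - y0 S\<bar> \<le> r n / \<kappa>"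
  proof eventually_elim
    case (elim n)
    have o: "orbit a \<gamma> E0 \<mu>0 y0" "orbit a \<gamma> (E n) (\<mu> n) (y n)" using y by (auto simp: stable_orbit_def)
    have b: "\<kappa> \<le> slope_quot a \<mu>0 s (y0 s) (y n s) \<and> \<bar>y n s - y0 s\<bar> \<le> 1" if "S \<le> s" for s
      by (rule k(3)[OF _ _ _ _ y(2) y(1) that]) (use elim k M_def in auto)
    show ?case
      by (rule bounded_repelled_bound[OF orbit_diff_deriv[OF o], where c="\<lambda>s. slope_quot a \<mu>0 s (y0 s) (y n s)" and b=1])
         (use b k(1) orbit_forcing_le[of "\<mu> n" \<mu>0 _ "y n _" a "E n" E0] in \<open>auto simp: r_def\<close>)
  qed
  moreover have "(\<lambda>n. r n / \<kappa>) \<longlonglongrightarrow> (2 * \<bar>\<mu>0 - \<mu>0\<bar> + 2 * \<bar>a\<bar> * \<bar>E0 - E0\<bar>) / \<kappa>"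
    unfolding r_def by (intro tendsto_intros lim) (use k in auto)
  ultimately have "(\<lambda>n. y n S - y0 S) \<longlonglongrightarrow> 0"
    by (intro Lim_null_comparison[of "\<lambda>n. y n S - y0 S" "\<lambda>n. r n / \<kappa>"]) auto
  then have "(\<lambda>n. y n S) \<longlonglongrightarrow> y0 S" by (simp add: LIM_zero_iff)
  then show ?thesis
    by (rule orbit_tendsto[OF _ _ lim, rotated 2]) (use y in \<open>auto simp: stable_orbit_def\<close>)
qed

text \<open>Shooting backwards: \<open>z n\<close> passes through the saddle's ordinate at time
  \<open>n\<close>, and \<open>orbit_tail\<close> confines all these orbits near it on
  \<open>[S, n]\<close>. A limit of their values at time \<open>S\<close> is the initial value of
  the wanted orbit, and the tail bounds, uniform in \<open>n\<close>, give its convergence.\<close>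

lemma stable_orbit_exists:
  assumes a: "0 < a" and E: "-1 < E" "E < 1"
  obtains y where "stable_orbit a \<gamma> E \<mu> y"
proof -
  define q where "q = - arccos E"
  have "\<exists>z. z (real n) = q \<and> orbit a \<gamma> E \<mu> z" for n :: nat using orbit_exists by metis
  then obtain z where z: "\<And>n. z n (real n) = q" "\<And>n. orbit a \<gamma> E \<mu> (z n)" by metis
  have tail: "\<exists>S. \<forall>n s. S \<le> s \<longrightarrow> s \<le> real n \<longrightarrow> \<bar>z n s - q\<bar> < e" if "0 < e" for e
  proof -
    obtain \<epsilon> where eps: "0 < \<epsilon>" "\<epsilon> \<le> e" "- arccos E + \<epsilon> < 0" "- pi < - arccos E - \<epsilon>"
      using shrink_radius[OF E \<open>0 < e\<close>] by blast
    from orbit_tail[OF a E eps(1,3,4), of "\<bar>\<mu>\<bar>" \<gamma>] obtain S \<delta> where S: "0 < \<delta>"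
      "\<And>E' \<mu>' y T s. \<bar>E' - E\<bar> < \<delta> \<Longrightarrow> \<bar>\<mu>'\<bar> \<le> \<bar>\<mu>\<bar> \<Longrightarrow> orbit a \<gamma> E' \<mu>' y \<Longrightarrow>
           \<bar>y T - - arccos E\<bar> < \<epsilon> \<Longrightarrow> S \<le> s \<Longrightarrow> s \<le> T \<Longrightarrow> \<bar>y s - - arccos E\<bar> < \<epsilon>"
      by metis
    have "\<bar>z n s - q\<bar> < e" if "S \<le> s" "s \<le> real n" for n s
      using S(2)[of E \<mu> "z n" "real n" s] S(1) z that eps by (simp add: q_def)
    then show ?thesis by blast
  qed
  from tail[of 1] obtain S where S: "\<And>n s. S \<le> s \<Longrightarrow> s \<le> real n \<Longrightarrow> \<bar>z n s - q\<bar> < 1" by auto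
  \<comment> \<open>Discarding the first \<open>N\<close> orbits leaves those with
    \<open>S \<le> real n\<close>, which are the ones that the bound at time \<open>S\<close>
    covers.\<close>
  define N where "N = nat \<lceil>S\<rceil>"
  have N: "S \<le> real (n + N)" for n unfolding N_def by (simp add: of_nat_ceiling add_increasing)
  have "bounded (range (\<lambda>n. z (n + N) S))"
  proof (rule boundedI[of _ "\<bar>q\<bar> + 1"])
    fix x assume "x \<in> range (\<lambda>n. z (n + N) S)"
    then obtain n where "x = z (n + N) S" by auto
    then have "\<bar>x - q\<bar> < 1" using S[OF order_refl N] by simp
    then show "norm x \<le> \<bar>q\<bar> + 1" unfolding real_norm_def by linarith
  qed
  then obtain Y r where r: "strict_mono r" "((\<lambda>n. z (n + N) S) \<circ> r) \<longlonglongrightarrow> Y"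
    using bounded_imp_convergent_subsequence by blast
  obtain y where y: "y S = Y" "orbit a \<gamma> E \<mu> y" using orbit_exists by metis
  have lim: "(\<lambda>n. z (r n + N) s) \<longlonglongrightarrow> y s" for s
    by (rule orbit_tendsto[OF z(2) y(2) tendsto_const tendsto_const, where t=S])
       (use r(2) y(1) in \<open>simp add: o_def\<close>)
  have "(y \<longlongrightarrow> q) at_top"
  proof (rule tendstoI)
    fix e :: real assume "0 < e"
    then obtain S' where S': "\<And>n s. S' \<le> s \<Longrightarrow> s \<le> real n \<Longrightarrow> \<bar>z n s - q\<bar> < e / 2"
      using tail[of "e / 2"] by auto
    have "\<bar>y s - q\<bar> < e" if s: "S' \<le> s" for s
    proof -
      have "\<forall>\<^sub>F n in sequentially. \<bar>z (r n + N) s - q\<bar> \<le> e / 2"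
      proof (rule eventually_sequentiallyI[of "nat \<lceil>s\<rceil>"])
        fix n assume "nat \<lceil>s\<rceil> \<le> n"
        then have "s \<le> real n" by linarith
        moreover have "n \<le> r n" using seq_suble[OF r(1)] .
        ultimately have "s \<le> real (r n + N)" by simp
        then show "\<bar>z (r n + N) s - q\<bar> \<le> e / 2" using S'[OF s] by (meson less_imp_le)
      qed
      then have "\<bar>y s - q\<bar> \<le> e / 2"
        by (rule tendsto_upperbound[OF tendsto_rabs[OF tendsto_diff[OF lim tendsto_const]]]) simp
      then show ?thesis using \<open>0 < e\<close> by simp
    qed
    then show "\<forall>\<^sub>F s in at_top. dist (y s) q < e"
      by (auto simp: eventually_at_top_linorder dist_real_def)
  qed
  then show ?thesis using y that by (auto simp: stable_orbit_def q_def)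
qed

section \<open>Existence and comparison of connectors\<close>

text \<open>If the orbit were on the wrong side of \<open>B\<close> at \<open>s1\<close>, it would
  leave \<open>B\<close> at once and never return. Near the saddle repulsion keeps the gap from
  shrinking, although both curves tend to the same point. The factor \<open>\<sigma>\<close> treats
  upper and lower barriers together.\<close>

lemma stable_orbit_barrier:
  assumes a: "0 < a" and E: "-1 < E" "E < 1" and y: "stable_orbit a \<gamma> E \<mu> y"
    and B: "(B \<longlongrightarrow> - arccos E) at_top" "\<And>s. s0 \<le> s \<Longrightarrow> (B has_real_derivative B' s) (at s)"
    and cmp: "\<And>s. s0 \<le> s \<Longrightarrow> 0 < \<sigma> * (slope a \<gamma> E \<mu> s (B s) - B' s)"
    and s1: "s0 \<le> s1"
  shows "\<sigma> * (y s1 - B s1) < 0"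
proof (rule ccontr)
  assume neg: "\<not> ?thesis"
  define D where "D = (\<lambda>s. \<sigma> * (y s - B s))"
  define D' where "D' = (\<lambda>s. \<sigma> * (slope a \<gamma> E \<mu> s (y s) - B' s))"
  have D: "(D has_real_derivative D' s) (at s)" if "s0 \<le> s" for s
    unfolding D_def D'_def using that y
    by (intro derivative_intros DERIV_cmult orbitD B) (auto simp: stable_orbit_def)
  have "\<sigma> \<noteq> 0" using cmp[of s0] by auto
  have pos: "0 < D s" if "s1 < s" for s
    by (rule strict_mono_barrier[where p=s1 and D'=D'])
       (use D cmp s1 that neg \<open>\<sigma> \<noteq> 0\<close> in \<open>auto simp: D_def D'_def\<close>)
  obtain \<kappa> \<epsilon> S where k: "0 < \<kappa>" "0 < \<epsilon>" "\<And>s x y. S \<le> s \<Longrightarrow>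
     \<bar>x + arccos E\<bar> < \<epsilon> \<Longrightarrow> \<bar>y + arccos E\<bar> < \<epsilon> \<Longrightarrow> \<kappa> \<le> slope_quot a \<mu> s x y"
    using slope_quot_lower[OF a E, of "\<bar>\<mu>\<bar>"] by (metis order_refl)
  have y_lim: "(y \<longlongrightarrow> - arccos E) at_top" using y by (simp add: stable_orbit_def)
  have "\<forall>\<^sub>F s in at_top. \<bar>y s + arccos E\<bar> < \<epsilon>" "\<forall>\<^sub>F s in at_top. \<bar>B s + arccos E\<bar> < \<epsilon>"
    using tendstoD[OF y_lim k(2)] tendstoD[OF B(1) k(2)] by (simp_all add: dist_real_def)
  then have "\<forall>\<^sub>F s in at_top. \<bar>y s + arccos E\<bar> < \<epsilon> \<and> \<bar>B s + arccos E\<bar> < \<epsilon>"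
    by (rule eventually_conj)
  then obtain T0 where T0: "\<And>s. T0 \<le> s \<Longrightarrow> \<bar>y s + arccos E\<bar> < \<epsilon>" "\<And>s. T0 \<le> s \<Longrightarrow> \<bar>B s + arccos E\<bar> < \<epsilon>"
    by (auto simp: eventually_at_top_linorder)
  define T where "T = max T0 (max S (s1 + 1))"
  have T: "T0 \<le> T" "S \<le> T" "s1 < T" "s0 \<le> T" unfolding T_def using s1 by linarith+
  have "D T \<le> D s" if "T \<le> s" for s
  proof (rule DERIV_nonneg_imp_nondecreasing[OF that])
    fix t assume t: "T \<le> t"
    have "D' t = slope_quot a \<mu> t (B t) (y t) * D t + \<sigma> * (slope a \<gamma> E \<mu> t (B t) - B' t)"
    proof -
      have "D' t = \<sigma> * (slope a \<gamma> E \<mu> t (y t) - slope a \<gamma> E \<mu> t (B t)) + \<sigma> * (slope a \<gamma> E \<mu> t (B t) - B' t)"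
        by (simp add: D'_def algebra_simps)
      then show ?thesis unfolding slope_diff by (simp add: D_def)
    qed
    moreover have "0 \<le> slope_quot a \<mu> t (B t) (y t)"
      using k(3)[of t "B t" "y t"] k(1) T0[of t] t T by auto
    moreover have "0 \<le> D t" using pos[of t] t T by simp
    ultimately have "0 \<le> D' t" using cmp[of t] t T by simp
    then show "\<exists>y. (D has_real_derivative y) (at t) \<and> 0 \<le> y" using D[of t] t T by auto
  qed
  moreover have "(D \<longlongrightarrow> \<sigma> * (- arccos E - - arccos E)) at_top"
    unfolding D_def by (intro tendsto_intros y_lim B)
  ultimately have "D T \<le> 0"
    by (intro tendsto_lowerbound[where F=at_top and f=D]) (auto simp: eventually_at_top_linorder)
  then show False using pos[OF T(3)] by simp
qed

text \<open>If the energies differed by more, the forcing would be negative wherever the curves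
  meet, so \<open>y2\<close> could cross \<open>y1\<close> only downwards. But \<open>arccos\<close>
  is decreasing, so the limits place \<open>y2\<close> below \<open>y1\<close> on the far left and
  above it on the far right. Equal \<open>\<mu>\<close> gives uniqueness, and in general this is a
  Lipschitz bound for \<open>\<E>\<close>.\<close>

lemma connector_energy_diff_le:
  assumes a: "0 < a" and E: "-1 < E1" "E1 < 1" "-1 < E2" "E2 < 1"
    and y1: "stable_orbit a \<gamma> E1 \<mu>1 y1" "unstable_orbit a \<gamma> E1 \<mu>1 y1"
    and y2: "stable_orbit a \<gamma> E2 \<mu>2 y2" "unstable_orbit a \<gamma> E2 \<mu>2 y2"
  shows "a * (E2 - E1) \<le> \<bar>\<mu>2 - \<mu>1\<bar>"
proof (rule ccontr)
  assume neg: "\<not> ?thesis"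
  then have "0 < a * (E2 - E1)" by linarith
  then have E12: "E1 < E2" using a by (simp add: zero_less_mult_iff)
  then have arc: "arccos E2 < arccos E1" using E by (intro arccos_less_arccos) auto
  have "((\<lambda>s. y2 s - y1 s) \<longlongrightarrow> - arccos E2 - - arccos E1) at_top"
    using y1 y2 by (intro tendsto_intros) (auto simp: stable_orbit_def)
  then have "\<forall>\<^sub>F s in at_top. 0 < y2 s - y1 s"
    by (rule order_tendstoD) (use arc in simp)
  then obtain q where q: "\<And>s. q \<le> s \<Longrightarrow> 0 < y2 s - y1 s" by (auto simp: eventually_at_top_linorder)
  have "((\<lambda>s. y2 s - y1 s) \<longlongrightarrow> - pi + arccos E2 - (- pi + arccos E1)) at_bot"
    using y1 y2 by (intro tendsto_intros) (auto simp: unstable_orbit_def)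
  then have "\<forall>\<^sub>F s in at_bot. y2 s - y1 s < 0"
    by (rule order_tendstoD) (use arc in simp)
  then obtain p where p: "\<And>s. s \<le> p \<Longrightarrow> y2 s - y1 s < 0" by (auto simp: eventually_at_bot_linorder)
  define p' where "p' = min p (q - 1)"
  have "0 < - (y2 q - y1 q)"
  proof (rule strict_mono_barrier[where p=p' and q=q and D="\<lambda>s. - (y2 s - y1 s)"])
    show "((\<lambda>s. - (y2 s - y1 s)) has_real_derivative
       - (slope_quot a \<mu>1 t (y1 t) (y2 t) * (y2 t - y1 t)
          + (2 * (\<mu>2 - \<mu>1) * cos (arctan t) * sin (y2 t) - 2 * a * (E2 - E1)))) (at t)" for t
      by (intro DERIV_minus orbit_diff_deriv) (use y1 y2 in \<open>auto simp: stable_orbit_def\<close>)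
    fix t assume "- (y2 t - y1 t) = 0"
    moreover have "\<bar>(\<mu>2 - \<mu>1) * cos (arctan t) * sin (y2 t)\<bar> \<le> \<bar>\<mu>2 - \<mu>1\<bar>"
      by (rule abs_mult_mult_le) auto
    then have "2 * ((\<mu>2 - \<mu>1) * cos (arctan t) * sin (y2 t)) < 2 * (a * (E2 - E1))"
      using neg by linarith
    ultimately show "0 < - (slope_quot a \<mu>1 t (y1 t) (y2 t) * (y2 t - y1 t)
          + (2 * (\<mu>2 - \<mu>1) * cos (arctan t) * sin (y2 t) - 2 * a * (E2 - E1)))"
      by (simp add: algebra_simps)
  next
    show "0 \<le> - (y2 p' - y1 p')" using p[of p'] by (simp add: p'_def)
    show "p' < q" by (simp add: p'_def min_def)
  qed
  then show False using q[of q] by simp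
qed

lemma has_saddles_connector_iff:
  "has_saddles_connector a \<gamma> E \<mu> \<longleftrightarrow> (\<exists>y. stable_orbit a \<gamma> E \<mu> y \<and> unstable_orbit a \<gamma> E \<mu> y)"
proof
  assume "has_saddles_connector a \<gamma> E \<mu>"
  then obtain x where x: "\<And>t. (x has_vector_derivative omega_field a \<gamma> E \<mu> (x t)) (at t)"
    "\<And>t. - pi / 2 < fst (x t)" "\<And>t. fst (x t) < pi / 2"
    "(x \<longlongrightarrow> saddle_minus E) at_bot" "(x \<longlongrightarrow> saddle_plus E) at_top"
    by (auto simp: has_saddles_connector_def)
  have fst: "((\<lambda>t. fst (x t)) has_real_derivative (cos (fst (x t)))\<^sup>2) (at t)" for t
    using bounded_linear.has_vector_derivative[OF bounded_linear_fst x(1)]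
    by (simp add: has_real_derivative_iff_has_vector_derivative omega_field_def Let_def)
  have snd: "((\<lambda>t. snd (x t)) has_real_derivative snd (omega_field a \<gamma> E \<mu> (x t))) (at t)" for t
    using bounded_linear.has_vector_derivative[OF bounded_linear_snd x(1)]
    by (simp add: has_real_derivative_iff_has_vector_derivative)
  have cos: "cos (fst (x t)) \<noteq> 0" for t using cos_gt_zero_pi[of "fst (x t)"] x(2,3)[of t] by simp
  \<comment> \<open>In the open strip \<open>tan\<close> is smooth and inverted by
    \<open>arctan\<close>, so this constant determines the first component completely.\<close>
  have "((\<lambda>t. tan (fst (x t)) - t) has_real_derivative 0) (at t)" for t
    using cos[of t] by (auto intro!: derivative_eq_intros fst simp: field_simps)
  then have const: "tan (fst (x t)) - t = tan (fst (x 0)) - 0" for t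
    using DERIV_isconst_all[of "\<lambda>t. tan (fst (x t)) - t"] by blast
  define c where "c = tan (fst (x 0))"
  have "tan (fst (x t)) = t + c" for t using const[of t] by (simp add: c_def)
  then have arc: "fst (x t) = arctan (t + c)" for t
    using arctan_tan[of "fst (x t)"] x(2,3)[of t] by simp
  define y where "y = (\<lambda>s. snd (x (s - c)))"
  have "(y has_real_derivative slope a \<gamma> E \<mu> s (y s)) (at s)" for s
  proof -
    have "snd (omega_field a \<gamma> E \<mu> (x (s - c))) = slope a \<gamma> E \<mu> s (y s)"
      using arc[of "s - c"] by (simp add: omega_field_def slope_def Let_def y_def)
    then show ?thesis
      unfolding y_def using snd[of "s - c"] DERIV_shift[of "\<lambda>t. snd (x t)" _ s "- c"] by simp
  qed
  moreover have "(y \<longlongrightarrow> - arccos E) at_top"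
  proof -
    have "filterlim (\<lambda>s. s - c) at_top at_top" by real_asymp
    from filterlim_compose[OF tendsto_snd[OF x(5)] this] show ?thesis
      by (simp add: y_def saddle_plus_def)
  qed
  moreover have "(y \<longlongrightarrow> - pi + arccos E) at_bot"
  proof -
    have "filterlim (\<lambda>s. s - c) at_bot at_bot" by real_asymp
    from filterlim_compose[OF tendsto_snd[OF x(4)] this] show ?thesis
      by (simp add: y_def saddle_minus_def)
  qed
  ultimately show "\<exists>y. stable_orbit a \<gamma> E \<mu> y \<and> unstable_orbit a \<gamma> E \<mu> y"
    by (auto simp: stable_orbit_def unstable_orbit_def orbit_def)
next
  assume "\<exists>y. stable_orbit a \<gamma> E \<mu> y \<and> unstable_orbit a \<gamma> E \<mu> y"
  then obtain y where y: "orbit a \<gamma> E \<mu> y" "(y \<longlongrightarrow> - arccos E) at_top" "(y \<longlongrightarrow> - pi + arccos E) at_bot"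
    by (auto simp: stable_orbit_def unstable_orbit_def)
  show "has_saddles_connector a \<gamma> E \<mu>"
    unfolding has_saddles_connector_def
  proof (intro exI[of _ "\<lambda>t. (arctan t, y t)"] conjI allI)
    fix t
    have "(arctan has_vector_derivative (cos (arctan t))\<^sup>2) (at t)"
      unfolding has_real_derivative_iff_has_vector_derivative[symmetric]
      using DERIV_arctan[of t] by (simp add: cos_arctan power_divide inverse_eq_divide)
    moreover have "(y has_vector_derivative slope a \<gamma> E \<mu> t (y t)) (at t)"
      using orbitD[OF y(1)] by (simp add: has_real_derivative_iff_has_vector_derivative)
    ultimately show "((\<lambda>t. (arctan t, y t)) has_vector_derivative omega_field a \<gamma> E \<mu> (arctan t, y t)) (at t)"
      using has_vector_derivative_Pair by (force simp: omega_field_def slope_def Let_def)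
    show "fst (arctan t, y t) \<in> {- pi / 2<..<pi / 2}"
      using arctan_bounded[of t] by simp
    show "((\<lambda>t. (arctan t, y t)) \<longlongrightarrow> saddle_minus E) at_bot"
      unfolding saddle_minus_def using tendsto_arctan_at_bot by (intro tendsto_Pair y) simp
    show "((\<lambda>t. (arctan t, y t)) \<longlongrightarrow> saddle_plus E) at_top"
      unfolding saddle_plus_def by (intro tendsto_Pair y tendsto_arctan_at_top)
  qed
qed

section \<open>Barriers at both ends of the energy range\<close>

lemma abs_cos_diff_le: "\<bar>cos x - cos y\<bar> \<le> \<bar>x - y\<bar>" for x y :: real
proof -
  have "\<bar>2 * sin ((y - x) / 2) * sin ((x + y) / 2)\<bar> \<le> 2 * \<bar>sin ((y - x) / 2)\<bar>"
    by (simp add: abs_mult mult_left_le)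
  also have "\<dots> \<le> \<bar>x - y\<bar>" using abs_sin_x_le_abs_x[of "(y - x) / 2"] by (simp add: abs_minus_commute)
  finally show ?thesis by (simp add: cos_diff_cos mult_ac)
qed

lemma cos_ge_quadratic: "1 - x\<^sup>2 / 2 \<le> cos x" for x :: real
proof -
  have "\<bar>sin (x / 2)\<bar>\<^sup>2 \<le> \<bar>x / 2\<bar>\<^sup>2"
    using abs_sin_x_le_abs_x[of "x / 2"] by (intro power_mono) auto
  then show ?thesis using cos_double_sin[of "x / 2"] by (simp add: power_divide)
qed

text \<open>At \<open>E = 0\<close> the horizontal line through the saddle is itself a barrier. On
  it the slope is a positive multiple of
  \<open>- 2 * \<mu> + 2 * \<gamma> * sin \<xi> + cos \<xi>\<close>, and
  \<open>- 2 * \<mu> \<ge> 2 - 2 * a > 1 > 2 * \<bar>\<gamma>\<bar>\<close>. Only the size of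
  \<open>\<gamma>\<close> matters, so the bound can be reflected.\<close>

lemma stable_orbit_E_0_less:
  assumes "0 < a" "a < 1 / 2" "\<bar>\<gamma>\<bar> < 1 / 2" "\<mu> \<le> -1 + a" "stable_orbit a \<gamma> 0 \<mu> y"
  shows "y s < - pi / 2"
proof -
  have pos: "0 < 1 * (slope a \<gamma> 0 \<mu> t (- pi / 2) - 0)" for t
  proof -
    have c: "0 < cos (arctan t)" by (rule cos_arctan_gt_0)
    have "\<bar>2 * \<gamma> * sin (arctan t)\<bar> \<le> 2 * \<bar>\<gamma>\<bar>"
      by (simp only: abs_mult abs_numeral) (simp add: mult_left_le)
    then have "0 < - 2 * \<mu> + 2 * \<gamma> * sin (arctan t) + cos (arctan t)"
      using assms c by linarith
    then have "0 < cos (arctan t) * (- 2 * \<mu> + 2 * \<gamma> * sin (arctan t) + cos (arctan t))"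
      using c by simp
    also have "\<dots> = slope a \<gamma> 0 \<mu> t (- pi / 2)"
      by (simp add: slope_def algebra_simps power2_eq_square)
    finally show ?thesis by simp
  qed
  have "1 * (y s - - pi / 2) < 0"
    by (rule stable_orbit_barrier[where B="\<lambda>_. - pi / 2" and B'="\<lambda>_. 0" and \<sigma>=1, OF _ _ _ assms(5) _ _ _ order_refl])
       (use assms pos in auto)
  then show ?thesis by simp
qed

text \<open>The orbit comes from below the line \<open>y = pi / 2 - 1 / 10\<close>, and the slope is
  negative all along it. The three contributions are at most \<open>a / 5\<close> from
  \<open>sin (1/10)\<close>, \<open>- 99 * a / 50\<close> from the energy, and
  \<open>3 * a / 2\<close> from the rest.\<close>

lemma unstable_orbit_below:
  assumes "0 < a" "a < 1 / 2" "\<bar>\<gamma>\<bar> < 1 / 2" "\<mu> \<le> -1 + a" "99 / 100 \<le> E" "E \<le> 1" "unstable_orbit a \<gamma> E \<mu> y"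
  shows "y s < pi / 2 - 1 / 10"
proof -
  let ?c = "pi / 2 - 1 / 10 :: real"
  have sc: "cos ?c = sin (1/10)" "sin ?c = cos (1/10)" by (simp_all add: cos_diff sin_diff)
  have s1: "0 \<le> sin (1/10::real)" "sin (1/10::real) \<le> 1/10"
    using pi_gt3 sin_ge_zero[of "1/10"] sin_x_le_x[of "1/10"] by auto
  have c1: "99/100 \<le> cos (1/10::real)" using cos_ge_quadratic[of "1/10"] by (simp add: power2_eq_square)
  have neg: "slope a \<gamma> E \<mu> t ?c < 0" for t
  proof -
    let ?S = "sin (arctan t)" and ?C = "cos (arctan t)"
    have C: "0 < ?C" "?C \<le> 1" using cos_arctan_gt_0[of t] by auto
    \<comment> \<open>This is \<open>\<bar>sin\<bar> + cos \<le> sqrt 2\<close> with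
      \<open>3/2\<close> as a rational substitute for the root.\<close>
    have "(\<bar>?S\<bar> + ?C)\<^sup>2 \<le> 2 * (\<bar>?S\<bar>\<^sup>2 + ?C\<^sup>2)"
      using sum_squares_bound[of "\<bar>?S\<bar>" ?C] by (simp add: power2_sum)
    also have "\<dots> = 2" by (simp add: sin_squared_eq)
    also have "\<dots> \<le> (3/2)\<^sup>2" by (simp add: power2_eq_square)
    finally have SC: "\<bar>?S\<bar> + ?C \<le> 3/2" by (rule power2_le_imp_le) simp
    have "\<bar>2 * \<gamma>\<bar> * \<bar>?S\<bar> \<le> 1 * \<bar>?S\<bar>" using assms by (intro mult_right_mono) auto
    then have "\<bar>2 * \<gamma> * ?S\<bar> \<le> \<bar>?S\<bar>" by (simp only: abs_mult mult_1)
    then have 1: "2 * \<gamma> * ?S + ?C \<le> 3/2" using SC unfolding abs_le_iff by linarith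
    have "2 * \<mu> * cos (1/10) \<le> 2 * \<mu> * (99/100)"
      using assms c1 by (intro mult_left_mono_neg) auto
    from add_mono[OF this 1] have "2 * \<mu> * cos (1/10) + (2 * \<gamma> * ?S + ?C) \<le> 2 * \<mu> * (99/100) + 3/2" .
    also have "\<dots> \<le> (198 * a - 48) / 100" using assms(4) by simp
    finally have "2 * \<mu> * cos (1/10) + (2 * \<gamma> * ?S + ?C) \<le> (198 * a - 48) / 100" .
    then have "?C * (2 * \<mu> * cos (1/10) + (2 * \<gamma> * ?S + ?C)) \<le> ?C * ((198 * a - 48) / 100)"
      using C by (intro mult_left_mono) auto
    also have "\<dots> \<le> 3/2 * a"
    proof (cases "198 * a - 48 \<le> 0")
      case True then have "?C * ((198 * a - 48) / 100) \<le> 0" using C by (intro mult_nonneg_nonpos) auto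
      then show ?thesis using assms by linarith
    next
      case False
      then have "?C * ((198 * a - 48) / 100) \<le> 1 * ((198 * a - 48) / 100)" using C by (intro mult_right_mono) auto
      also have "\<dots> \<le> 3/2 * a" using assms(1,2) by simp
      finally show ?thesis .
    qed
    finally have 2: "?C * (2 * \<mu> * cos (1/10) + (2 * \<gamma> * ?S + ?C)) \<le> 3/2 * a" .
    have "(2 * a) * (?S * sin (1/10)) \<le> (2 * a) * (1 * (1/10))"
      using assms s1 by (intro mult_left_mono mult_mono) auto
    moreover have "(2 * a) * (99/100) \<le> (2 * a) * E" using assms by (intro mult_left_mono) auto
    moreover have "slope a \<gamma> E \<mu> t ?c = (2 * a) * (?S * sin (1/10)) - (2 * a) * E
       + ?C * (2 * \<mu> * cos (1/10) + (2 * \<gamma> * ?S + ?C))"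
      unfolding slope_def sc by (simp add: algebra_simps power2_eq_square)
    ultimately show ?thesis using 2 assms by linarith
  qed
  have "arccos E \<le> pi / 2" using assms by (intro arccos_le_pi2) auto
  then have "- pi + arccos E < ?c" using pi_gt3 by linarith
  moreover have "(y \<longlongrightarrow> - pi + arccos E) at_bot" using assms by (simp add: unstable_orbit_def)
  ultimately have "\<forall>\<^sub>F t in at_bot. y t < ?c" by (intro order_tendstoD(2))
  then obtain p where "\<And>t. t \<le> p \<Longrightarrow> y t < ?c" by (auto simp: eventually_at_bot_linorder)
  then show ?thesis
    using assms neg orbit_stays_below[of a \<gamma> E \<mu> y "min p (s - 1)" ?c s]
    by (force simp: unstable_orbit_def less_imp_le)
qed

text \<open>For \<open>\<delta> = 0\<close> the line \<open>\<Omega> = \<pi>/2 - \<xi> - \<delta>\<close> is a barrier on \<open>\<xi> > 0\<close> only, where \<open>\<gamma> sin \<xi> < 0\<close>. To absorb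
  a small \<open>\<delta> = arccos E\<close> one has to stay away from \<open>\<xi> = 0\<close>; the margin \<open>1/10\<close> in the bound for the
  unstable orbit makes room for that, and the two are compared at \<open>\<xi> = 1/20\<close>.\<close>

lemma stable_orbit_above:
  assumes a: "0 < a" and \<mu>: "\<mu> \<le> -1 + a" and \<gamma>: "\<gamma> < 0" and \<delta>: "0 < \<delta>" "\<delta> < pi"
    and x: "0 \<le> x" "x < pi / 2" and small: "(a - \<mu>) * \<delta> + \<gamma> * sin x < 0"
    and y: "stable_orbit a \<gamma> (cos \<delta>) \<mu> y"
  shows "pi / 2 - x - \<delta> < y (tan x)"
proof -
  have arc: "arccos (cos \<delta>) = \<delta>" using \<delta> by (intro arccos_cos) auto
  have E: "-1 < cos \<delta>" "cos \<delta> < 1"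
    using cos_monotone_0_pi[of 0 \<delta>] cos_monotone_0_pi[of \<delta> pi] \<delta> by auto
  have cmp: "0 < - 1 * (slope a \<gamma> (cos \<delta>) \<mu> s (pi / 2 - arctan s - \<delta>) - - (cos (arctan s))\<^sup>2)"
    if s: "tan x \<le> s" for s
  proof -
    let ?z = "arctan s"
    have xz: "x \<le> ?z" "?z < pi / 2"
      using arctan_monotone'[OF s] arctan_tan[of x] x arctan_bounded[of s] by auto
    have C: "0 < cos ?z" by (rule cos_arctan_gt_0)
    have "sin x \<le> sin ?z" using xz x by (subst sin_mono_le_eq) auto
    then have 1: "\<gamma> * sin ?z \<le> \<gamma> * sin x" using \<gamma> by (simp add: mult_le_cancel_left)
    \<comment> \<open>Shifting the cosine by \<open>\<delta>\<close> costs at most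
      \<open>(a - \<mu>) * \<delta>\<close>, which \<open>small\<close> pays for with
      \<open>\<gamma> * sin x\<close>. The isolated \<open>cos ?z\<close> is absorbed because
      \<open>a - \<mu> \<ge> 1\<close>.\<close>
    have "cos ?z - cos (?z + \<delta>) \<le> \<delta>" using abs_cos_diff_le[of ?z "?z + \<delta>"] \<delta> by simp
    then have "(a - \<mu>) * (cos ?z - \<delta>) \<le> (a - \<mu>) * cos (?z + \<delta>)"
      using a \<mu> by (intro mult_left_mono) auto
    moreover have "1 * cos ?z \<le> (a - \<mu>) * cos ?z" using \<mu> C by (intro mult_right_mono) auto
    ultimately have neg: "(\<mu> - a) * cos (?z + \<delta>) + cos ?z + \<gamma> * sin ?z < 0"
      using 1 small by (simp add: algebra_simps)
    have e: "cos (pi / 2 - ?z - \<delta>) = sin (?z + \<delta>)" "sin (pi / 2 - ?z - \<delta>) = cos (?z + \<delta>)"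
      using sin_cos_eq[of "?z + \<delta>"] cos_sin_eq[of "?z + \<delta>"] by (simp_all add: diff_diff_eq)
    \<comment> \<open>Writing the energy as the cosine of \<open>(?z + \<delta>) - ?z\<close>
      cancels the product of sines in the slope and leaves the common factor
      \<open>2 * cos ?z\<close>.\<close>
    have "cos \<delta> = cos (?z + \<delta>) * cos ?z + sin (?z + \<delta>) * sin ?z"
      using cos_diff[of "?z + \<delta>" ?z] by simp
    then have "slope a \<gamma> (cos \<delta>) \<mu> s (pi / 2 - ?z - \<delta>) - - (cos ?z)\<^sup>2
      = 2 * cos ?z * ((\<mu> - a) * cos (?z + \<delta>) + cos ?z + \<gamma> * sin ?z)"
      unfolding slope_def e by (simp add: algebra_simps power2_eq_square)
    then show ?thesis using C neg by (simp add: mult_pos_neg)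
  qed
  have "- 1 * (y (tan x) - (pi / 2 - arctan (tan x) - \<delta>)) < 0"
  proof (rule stable_orbit_barrier[OF a E y _ _ cmp order_refl])
    have "((\<lambda>s. pi / 2 - arctan s - \<delta>) \<longlongrightarrow> pi / 2 - pi / 2 - \<delta>) at_top"
      by (intro tendsto_intros tendsto_arctan_at_top)
    then show "((\<lambda>s. pi / 2 - arctan s - \<delta>) \<longlongrightarrow> - arccos (cos \<delta>)) at_top" by (simp add: arc)
    show "((\<lambda>s. pi / 2 - arctan s - \<delta>) has_real_derivative - (cos (arctan s))\<^sup>2) (at s)" for s
      by (auto intro!: derivative_eq_intros simp: cos_arctan power_divide inverse_eq_divide)
  qed
  then show ?thesis using arctan_tan[of x] x by simp
qed

lemma connector_exists:
  assumes a: "0 < a" "a < 1 / 2" and \<gamma>: "\<bar>\<gamma>\<bar> < 1 / 2" "\<gamma> < 0" and \<mu>: "\<mu> \<le> -1 + a"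
  shows "\<exists>E y. 0 < E \<and> E < 1 \<and> stable_orbit a \<gamma> E \<mu> y \<and> unstable_orbit a \<gamma> E \<mu> y"
proof -
  define s0 :: real where "s0 = tan (1/20)"
  have "\<exists>y. stable_orbit a \<gamma> E \<mu> y" "\<exists>y. stable_orbit a (- \<gamma>) E \<mu> y" if "-1 < E" "E < 1" for E
    using stable_orbit_exists[OF a(1) that] by metis+
  then obtain Y Z where Y: "\<And>E. -1 < E \<Longrightarrow> E < 1 \<Longrightarrow> stable_orbit a \<gamma> E \<mu> (Y E)"
    and Z: "\<And>E. -1 < E \<Longrightarrow> E < 1 \<Longrightarrow> stable_orbit a (- \<gamma>) E \<mu> (Z E)" by metis
  define U where "U = (\<lambda>E s. - pi - Z E (- s))"
  have U: "unstable_orbit a \<gamma> E \<mu> (U E)" if "-1 < E" "E < 1" for E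
    using stable_imp_unstable_reflect[OF Z[OF that]] by (simp add: U_def)
  have sin_pos: "0 < sin (1/20::real)" using pi_gt3 by (intro sin_gt_zero) auto
  \<comment> \<open>The second bound makes \<open>(a - \<mu>) * \<delta>\<close> at most half of
    \<open>- \<gamma> * sin (1/20)\<close>. The first gives
    \<open>1/20 + \<delta> \<le> 1/10\<close>, which orders the two barriers at
    \<open>\<xi> = 1/20\<close>, and keeps \<open>cos \<delta>\<close> above
    \<open>99/100\<close>.\<close>
  define \<delta> where "\<delta> = min (1/20) (- \<gamma> * sin (1/20) / (2 * (a - \<mu>)))"
  have am: "1 \<le> a - \<mu>" using \<mu> by simp
  have "0 < - \<gamma> * sin (1/20) / (2 * (a - \<mu>))"
    using \<gamma> sin_pos am by (intro divide_pos_pos mult_pos_pos) auto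
  then have "0 < \<delta>" unfolding \<delta>_def min_less_iff_conj by simp
  moreover have "\<delta> \<le> 1/20" unfolding \<delta>_def by (rule min.cobounded1)
  moreover have "\<delta> \<le> - \<gamma> * sin (1/20) / (2 * (a - \<mu>))" unfolding \<delta>_def by (rule min.cobounded2)
  ultimately have \<delta>: "0 < \<delta>" "\<delta> \<le> 1/20" "\<delta> \<le> - \<gamma> * sin (1/20) / (2 * (a - \<mu>))"
    by simp_all
  have "(a - \<mu>) * \<delta> \<le> (a - \<mu>) * (- \<gamma> * sin (1/20) / (2 * (a - \<mu>)))"
    using \<delta>(3) am by (intro mult_left_mono) auto
  also have "\<dots> = - \<gamma> * sin (1/20) / 2"
  proof -
    have halve: "k * (c / (2 * k)) = c / 2" if "k \<noteq> 0" for k c :: real using that by simp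
    show ?thesis by (rule halve) (use am in linarith)
  qed
  also have "\<dots> < - \<gamma> * sin (1/20)" using \<gamma> sin_pos by (simp add: mult_neg_pos)
  finally have small: "(a - \<mu>) * \<delta> + \<gamma> * sin (1/20) < 0" by simp
  define E1 where "E1 = cos \<delta>"
  have "\<delta>\<^sup>2 \<le> (1/20)\<^sup>2" using \<delta> by (intro power_mono) auto
  then have E1: "99/100 \<le> E1" "E1 < 1"
    using cos_ge_quadratic[of \<delta>] cos_monotone_0_pi[of 0 \<delta>] \<delta> pi_gt3 by (auto simp: E1_def power2_eq_square)
  \<comment> \<open>One section \<open>s0\<close> suffices: if the two orbits agree at
    \<open>s0\<close>, uniqueness of solutions makes them one curve.\<close>
  define g where "g = (\<lambda>E. Y E s0 - U E s0)"
  have "Y 0 s0 < - pi / 2"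
    by (rule stable_orbit_E_0_less[OF a \<gamma>(1) \<mu> Y]) auto
  moreover have "Z 0 (- s0) < - pi / 2"
    by (rule stable_orbit_E_0_less[OF a _ \<mu> Z]) (use \<gamma> in auto)
  ultimately have g0: "g 0 < 0" by (simp add: g_def U_def)
  have "U E1 s0 < pi / 2 - 1/10"
    by (rule unstable_orbit_below[OF a \<gamma>(1) \<mu> E1(1) _ U]) (use E1 in auto)
  moreover have "pi / 2 - 1/20 - \<delta> < Y E1 s0"
    unfolding s0_def
    by (rule stable_orbit_above[OF a(1) \<mu> \<gamma>(2) \<delta>(1) _ _ _ small])
       (use \<delta> pi_gt3 E1 Y[of E1] in \<open>auto simp: E1_def\<close>)
  ultimately have g1: "0 < g E1" using \<delta>(2) by (simp add: g_def)
  have "continuous_on {0..E1} g"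
    unfolding continuous_on_sequentially
  proof (intro allI ballI impI)
    fix e E assume E: "E \<in> {0..E1}" and e: "(\<forall>n. e n \<in> {0..E1}) \<and> e \<longlonglongrightarrow> E"
    have b: "-1 < E" "E < 1" "-1 < e n" "e n < 1" for n
      using E e E1(2) by (auto simp: less_le_trans[of "-1" 0] intro: le_less_trans)
    have "(\<lambda>n. Y (e n) s0) \<longlonglongrightarrow> Y E s0"
      by (rule stable_orbit_tendsto[OF a(1) _ _ Y Y _ tendsto_const]) (use b e in auto)
    moreover have "(\<lambda>n. Z (e n) (- s0)) \<longlonglongrightarrow> Z E (- s0)"
      by (rule stable_orbit_tendsto[OF a(1) _ _ Z Z _ tendsto_const]) (use b e in auto)
    ultimately have "(\<lambda>n. Y (e n) s0 - (- pi - Z (e n) (- s0))) \<longlonglongrightarrow> Y E s0 - (- pi - Z E (- s0))"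
      by (intro tendsto_intros)
    then show "(g \<circ> e) \<longlonglongrightarrow> g E" by (simp add: g_def U_def o_def)
  qed
  then obtain E where E: "0 \<le> E" "E \<le> E1" "g E = 0"
    using IVT'[of g 0 0 E1] g0 g1 E1 by force
  have b: "0 < E" "E < 1" using E g0 E1 by (auto simp: order_le_less)
  have "Y E = U E"
    by (rule orbit_unique[of a \<gamma> E \<mu> _ _ s0])
       (use Y[of E] U[of E] b E(3) in \<open>auto simp: stable_orbit_def unstable_orbit_def g_def\<close>)
  then show ?thesis using Y[of E] U[of E] b by auto
qed

section \<open>Weighted means along connectors\<close>

text \<open>For continuous \<open>f\<close> this is the integral from 0 with orientation, valid also
  for negative arguments.\<close>

definition primitive :: "(real \<Rightarrow> real) \<Rightarrow> real \<Rightarrow> real" where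
  "primitive f = (SOME G. G 0 = 0 \<and> (\<forall>s. (G has_real_derivative f s) (at s)))"

text \<open>The integrating factor of \<open>D' = c * D + f\<close>, normalised to 1 at 0 for
  continuous \<open>c\<close>.\<close>

definition damping :: "(real \<Rightarrow> real) \<Rightarrow> real \<Rightarrow> real" where
  "damping c s = exp (- primitive c s)"

lemma
  assumes "continuous_on UNIV f"
  shows primitive_0: "primitive f 0 = 0"
    and DERIV_primitive: "(primitive f has_real_derivative f s) (at s)"
proof -
  have "\<exists>G. G 0 = 0 \<and> (\<forall>s. (G has_real_derivative f s) (at s))"
    using real_antiderivative[OF assms] by metis
  from someI_ex[OF this] show "primitive f 0 = 0" "(primitive f has_real_derivative f s) (at s)"
    by (auto simp: primitive_def)
qed

text \<open>The coefficients along converging connectors are known to converge only pointwise; the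
  common bound \<open>L\<close> permits dominated convergence on each compact interval.\<close>

lemma primitive_tendsto:
  assumes f: "\<And>n. continuous_on UNIV (f n)" and g: "continuous_on UNIV g"
    and bd: "\<And>n s. \<bar>f n s\<bar> \<le> L" and lim: "\<And>s. (\<lambda>n. f n s) \<longlonglongrightarrow> g s"
  shows "(\<lambda>n. primitive (f n) s) \<longlonglongrightarrow> primitive g s"
proof -
  have ftc: "(h has_integral primitive h q - primitive h p) {p..q}"
    if "continuous_on UNIV h" "p \<le> q" for h p q
    by (rule fundamental_theorem_of_calculus[OF that(2)])
       (auto simp: has_real_derivative_iff_has_vector_derivative[symmetric]
         intro: has_field_derivative_at_within DERIV_primitive[OF that(1)])
  have lim_int: "(\<lambda>n. primitive (f n) q - primitive (f n) p) \<longlonglongrightarrow> primitive g q - primitive g p"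
    if "p \<le> q" for p q
  proof -
    have "(\<lambda>n. integral {p..q} (f n)) \<longlonglongrightarrow> integral {p..q} g"
    proof (rule dominated_convergence(2)[where h="\<lambda>_. L"])
      show "f n integrable_on {p..q}" for n using ftc[OF f that] by blast
      show "(\<lambda>_. L) integrable_on {p..q}" by (rule integrable_const_ivl)
    qed (use bd lim in auto)
    then show ?thesis
      by (simp add: integral_unique[OF ftc[OF f that]] integral_unique[OF ftc[OF g that]])
  qed
  show ?thesis
  proof (cases "0 \<le> s")
    case True
    from lim_int[OF this] show ?thesis by (simp add: primitive_0 f g)
  next
    case False
    then have "s \<le> 0" by simp
    from tendsto_minus[OF lim_int[OF this]] show ?thesis by (simp add: primitive_0 f g)
  qed
qed

text \<open>Up to time \<open>S\<close> the rate may be as low as \<open>- L\<close>, afterwards it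
  is at least \<open>\<kappa>\<close>. Compared with the line of slope \<open>\<kappa>\<close>, the
  loss is at most \<open>(L + \<kappa>) * S\<close>.\<close>

lemma growth_lower_bound:
  fixes G c :: "real \<Rightarrow> real"
  assumes G: "G 0 = 0" "\<And>s. (G has_real_derivative c s) (at s)"
    and c: "\<And>s. \<bar>c s\<bar> \<le> L" "\<And>s. S \<le> s \<Longrightarrow> \<kappa> \<le> c s" and "0 \<le> S" "0 < \<kappa>" "0 \<le> s"
  shows "\<kappa> * s - (L + \<kappa>) * S \<le> G s"
proof -
  have L: "0 \<le> L" using c(1)[of 0] by linarith
  have 1: "G 0 + (L + \<kappa>) * 0 - \<kappa> * 0 \<le> G t + (L + \<kappa>) * t - \<kappa> * t" if "0 \<le> t" for t
  proof (rule DERIV_nonneg_imp_nondecreasing[OF that])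
    fix x
    have "((\<lambda>t. G t + (L + \<kappa>) * t - \<kappa> * t) has_real_derivative (c x + L)) (at x)"
      by (auto intro!: derivative_eq_intros G)
    moreover have "0 \<le> c x + L" using c(1)[of x] by linarith
    ultimately show "\<exists>y. ((\<lambda>t. G t + (L + \<kappa>) * t - \<kappa> * t) has_real_derivative y) (at x) \<and> 0 \<le> y" by blast
  qed
  show ?thesis
  proof (cases "s \<le> S")
    case True
    have "(L + \<kappa>) * s \<le> (L + \<kappa>) * S" using True L \<open>0 < \<kappa>\<close> by (intro mult_left_mono) auto
    then show ?thesis using 1[OF \<open>0 \<le> s\<close>] G by simp
  next
    case False
    then have "S \<le> s" by simp
    then have "G S - \<kappa> * S \<le> G s - \<kappa> * s"
    proof (rule DERIV_nonneg_imp_nondecreasing)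
      fix x assume "S \<le> x"
      have "((\<lambda>t. G t - \<kappa> * t) has_real_derivative (c x - \<kappa>)) (at x)"
        by (auto intro!: derivative_eq_intros G)
      moreover have "0 \<le> c x - \<kappa>" using c(2)[OF \<open>S \<le> x\<close>] by simp
      ultimately show "\<exists>y. ((\<lambda>t. G t - \<kappa> * t) has_real_derivative y) (at x) \<and> 0 \<le> y" by blast
    qed
    then show ?thesis using 1[OF \<open>0 \<le> S\<close>] G by simp
  qed
qed

text \<open>The right-hand side involves \<open>c\<close> only through \<open>L\<close>,
  \<open>\<kappa>\<close> and \<open>S\<close>, so it dominates a whole family of weights with
  common constants.\<close>

lemma damping_le:
  assumes c: "continuous_on UNIV c" "\<And>s. \<bar>c s\<bar> \<le> L"
    "\<And>s. S \<le> s \<Longrightarrow> \<kappa> \<le> c s" "\<And>s. s \<le> - S \<Longrightarrow> c s \<le> - \<kappa>" and "0 \<le> S" "0 < \<kappa>"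
  shows "damping c s \<le> exp ((L + \<kappa>) * S) * exp (- (\<kappa> * \<bar>s\<bar>))"
proof -
  have "\<kappa> * \<bar>s\<bar> - (L + \<kappa>) * S \<le> primitive c s"
  proof (cases "0 \<le> s")
    case True
    then show ?thesis
      using growth_lower_bound[OF primitive_0[OF c(1)] DERIV_primitive[OF c(1)] c(2,3)] assms by simp
  next
    case False
    have neg: "\<kappa> \<le> - c (- t)" if "S \<le> t" for t using c(4)[of "- t"] that by simp
    have "\<kappa> * (- s) - (L + \<kappa>) * S \<le> primitive c (- (- s))"
    proof (rule growth_lower_bound[where G="\<lambda>s. primitive c (- s)" and c="\<lambda>s. - c (- s)"])
      show "((\<lambda>s. primitive c (- s)) has_real_derivative - c (- t)) (at t)" for t
        using DERIV_primitive[OF c(1), of "- t"] by (simp add: DERIV_mirror)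
    qed (use assms False neg in \<open>auto simp: primitive_0\<close>)
    then show ?thesis using False by simp
  qed
  then show ?thesis by (simp add: damping_def exp_add[symmetric])
qed

lemma integrable_exp_neg_abs:
  fixes \<kappa> :: real
  assumes "0 < \<kappa>" shows "integrable lborel (\<lambda>s. exp (- (\<kappa> * \<bar>s\<bar>)))"
proof -
  let ?f = "\<lambda>s::real. indicator {0<..} s *\<^sub>R exp (- (s * \<kappa>))"
  have "integrable lborel ?f"
    using integrable_I0i_exp_mscale[OF assms] by (simp add: set_integrable_def)
  moreover from lborel_integrable_real_affine[OF this, of "-1" 0]
  have "integrable lborel (\<lambda>s. ?f (- s))" by simp
  ultimately have "integrable lborel (\<lambda>s. ?f s + ?f (- s))" by (rule Bochner_Integration.integrable_add)
  moreover have "AE s in lborel. exp (- (\<kappa> * \<bar>s\<bar>)) = ?f s + ?f (- s)"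
    using AE_lborel_singleton[of "0::real"]
    by eventually_elim (auto simp: indicator_def mult.commute abs_if)
  ultimately show ?thesis by (subst integrable_cong_AE) auto
qed

text \<open>The point 0 is exempt because \<open>cos (arctan 0) = 1\<close>, so the strict
  inequality between the two integrands of interest may fail there.\<close>

lemma LINT_pos:
  fixes f :: "real \<Rightarrow> real"
  assumes f: "integrable lborel f" and nonneg: "\<And>s. 0 \<le> f s" and pos: "\<And>s. s \<noteq> 0 \<Longrightarrow> 0 < f s"
  shows "0 < (LINT s|lborel. f s)"
proof (rule ccontr)
  assume "\<not> ?thesis"
  then have "(LINT s|lborel. f s) = 0"
    using Bochner_Integration.integral_nonneg[of lborel f, OF nonneg] by simp
  then have "AE s in lborel. f s = 0"
    using integral_nonneg_eq_0_iff_AE[OF f] nonneg by simp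
  with AE_lborel_singleton[of "0::real"] have "AE s in (lborel :: real measure). False"
    by eventually_elim (use pos in force)
  then have "ae_filter (lborel :: real measure) = bot" by (simp add: trivial_limit_def)
  then show False unfolding ae_filter_eq_bot_iff by simp
qed

section \<open>The mean identity for connectors and its limit\<close>

definition connector :: "real \<Rightarrow> real \<Rightarrow> real \<Rightarrow> real \<Rightarrow> (real \<Rightarrow> real) \<Rightarrow> bool" where
  "connector a \<gamma> E \<mu> y \<longleftrightarrow> stable_orbit a \<gamma> E \<mu> y \<and> unstable_orbit a \<gamma> E \<mu> y"

lemma connector_orbit: "connector a \<gamma> E \<mu> y \<Longrightarrow> orbit a \<gamma> E \<mu> y"
  by (simp add: connector_def stable_orbit_def)

lemma orbit_continuous: "orbit a \<gamma> E \<mu> y \<Longrightarrow> continuous_on UNIV y"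
  by (rule DERIV_continuous_on) (rule has_field_derivative_at_within[OF orbitD])

text \<open>The left end is the right end for \<open>- \<gamma>\<close>, reflected. The constants
  are fixed before the connectors, which is what domination along a sequence of connectors
  requires.\<close>

lemma connector_slope_quot_bounds:
  fixes a \<gamma> E0 M :: real
  assumes a: "0 < a" and E0: "-1 < E0" "E0 < 1"
  shows "\<exists>\<kappa> S \<delta>. 0 < \<kappa> \<and> 0 \<le> S \<and> 0 < \<delta> \<and> (\<forall>E1 E2 \<mu>1 \<mu>2 y1 y2. \<bar>E1 - E0\<bar> < \<delta> \<longrightarrow> \<bar>E2 - E0\<bar> < \<delta> \<longrightarrow>
     \<bar>\<mu>1\<bar> \<le> M \<longrightarrow> \<bar>\<mu>2\<bar> \<le> M \<longrightarrow> connector a \<gamma> E1 \<mu>1 y1 \<longrightarrow> connector a \<gamma> E2 \<mu>2 y2 \<longrightarrow>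
     (\<forall>s\<ge>S. \<kappa> \<le> slope_quot a \<mu>1 s (y1 s) (y2 s) \<and> \<bar>y2 s - y1 s\<bar> \<le> 1) \<and>
     (\<forall>s\<le>-S. slope_quot a \<mu>1 s (y1 s) (y2 s) \<le> - \<kappa> \<and> \<bar>y2 s - y1 s\<bar> \<le> 1))"
proof -
  obtain \<kappa>1 S1 \<delta>1 where 1: "0 < \<kappa>1" "0 < \<delta>1" "\<And>E1 E2 \<mu>1 \<mu>2 y1 y2 s. \<bar>E1 - E0\<bar> < \<delta>1 \<Longrightarrow> \<bar>E2 - E0\<bar> < \<delta>1 \<Longrightarrow>
     \<bar>\<mu>1\<bar> \<le> M \<Longrightarrow> \<bar>\<mu>2\<bar> \<le> M \<Longrightarrow> stable_orbit a \<gamma> E1 \<mu>1 y1 \<Longrightarrow> stable_orbit a \<gamma> E2 \<mu>2 y2 \<Longrightarrow> S1 \<le> s \<Longrightarrow>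
     \<kappa>1 \<le> slope_quot a \<mu>1 s (y1 s) (y2 s) \<and> \<bar>y2 s - y1 s\<bar> \<le> 1"
    using stable_slope_quot_lower[OF a E0, of M \<gamma>] by metis
  obtain \<kappa>2 S2 \<delta>2 where 2: "0 < \<kappa>2" "0 < \<delta>2" "\<And>E1 E2 \<mu>1 \<mu>2 y1 y2 s. \<bar>E1 - E0\<bar> < \<delta>2 \<Longrightarrow> \<bar>E2 - E0\<bar> < \<delta>2 \<Longrightarrow>
     \<bar>\<mu>1\<bar> \<le> M \<Longrightarrow> \<bar>\<mu>2\<bar> \<le> M \<Longrightarrow> stable_orbit a (- \<gamma>) E1 \<mu>1 y1 \<Longrightarrow> stable_orbit a (- \<gamma>) E2 \<mu>2 y2 \<Longrightarrow> S2 \<le> s \<Longrightarrow>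
     \<kappa>2 \<le> slope_quot a \<mu>1 s (y1 s) (y2 s) \<and> \<bar>y2 s - y1 s\<bar> \<le> 1"
    using stable_slope_quot_lower[OF a E0, of M "- \<gamma>"] by metis
  define \<kappa> S \<delta> where "\<kappa> = min \<kappa>1 \<kappa>2" and "S = max 0 (max S1 S2)" and "\<delta> = min \<delta>1 \<delta>2"
  have dom: "\<kappa> \<le> \<kappa>1" "\<kappa> \<le> \<kappa>2" "S1 \<le> S" "S2 \<le> S" "0 \<le> S" "\<delta> \<le> \<delta>1" "\<delta> \<le> \<delta>2"
    by (auto simp: \<kappa>_def S_def \<delta>_def)
  show ?thesis
  proof (rule exI[of _ \<kappa>], rule exI[of _ S], rule exI[of _ \<delta>], intro conjI[where P="0 < \<kappa>"] conjI[where P="0 \<le> S"]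
      conjI[where P="0 < \<delta>"] allI impI)
    fix E1 E2 \<mu>1 \<mu>2 y1 y2
    assume H: "\<bar>E1 - E0\<bar> < \<delta>" "\<bar>E2 - E0\<bar> < \<delta>" "\<bar>\<mu>1\<bar> \<le> M" "\<bar>\<mu>2\<bar> \<le> M"
      "connector a \<gamma> E1 \<mu>1 y1" "connector a \<gamma> E2 \<mu>2 y2"
    have st: "stable_orbit a \<gamma> E1 \<mu>1 y1" "stable_orbit a \<gamma> E2 \<mu>2 y2"
      using H by (auto simp: connector_def)
    have un: "stable_orbit a (- \<gamma>) E1 \<mu>1 (\<lambda>s. - pi - y1 (- s))" "stable_orbit a (- \<gamma>) E2 \<mu>2 (\<lambda>s. - pi - y2 (- s))"
      using H by (auto simp: connector_def intro: unstable_imp_stable_reflect)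
    have p: "\<kappa> \<le> slope_quot a \<mu>1 s (y1 s) (y2 s) \<and> \<bar>y2 s - y1 s\<bar> \<le> 1" if "S \<le> s" for s
      using 1(3)[OF _ _ H(3,4) st, of s] H(1,2) dom that by linarith
    have n: "slope_quot a \<mu>1 s (y1 s) (y2 s) \<le> - \<kappa> \<and> \<bar>y2 s - y1 s\<bar> \<le> 1" if "s \<le> - S" for s
    proof -
      have "\<kappa>2 \<le> slope_quot a \<mu>1 (- s) (- pi - y1 (- (- s))) (- pi - y2 (- (- s)))
          \<and> \<bar>(- pi - y2 (- (- s))) - (- pi - y1 (- (- s)))\<bar> \<le> 1"
        by (rule 2(3)[OF _ _ H(3,4) un]) (use H(1,2) dom that in linarith)+
      then have "\<kappa>2 \<le> - slope_quot a \<mu>1 s (y1 s) (y2 s) \<and> \<bar>y2 s - y1 s\<bar> \<le> 1"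
        unfolding minus_minus slope_quot_reflect by (simp add: abs_minus_commute)
      then show ?thesis using dom(2) by linarith
    qed
    show "(\<forall>s\<ge>S. \<kappa> \<le> slope_quot a \<mu>1 s (y1 s) (y2 s) \<and> \<bar>y2 s - y1 s\<bar> \<le> 1) \<and>
     (\<forall>s\<le>-S. slope_quot a \<mu>1 s (y1 s) (y2 s) \<le> - \<kappa> \<and> \<bar>y2 s - y1 s\<bar> \<le> 1)"
      using p n by blast
  qed (use 1(1,2) 2(1,2) dom in \<open>auto simp: \<kappa>_def \<delta>_def\<close>)
qed

lemma slope_quot_continuous:
  assumes "continuous_on UNIV x" "continuous_on UNIV y"
  shows "continuous_on UNIV (\<lambda>s. slope_quot a \<mu> s (x s) (y s))"
  unfolding slope_quot_def by (intro continuous_intros assms) auto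

lemma damping_measurable:
  assumes "continuous_on UNIV c" shows "damping c \<in> borel_measurable borel"
proof -
  have "continuous_on UNIV (primitive c)"
    by (rule DERIV_continuous_on) (rule has_field_derivative_at_within[OF DERIV_primitive[OF assms]])
  then have "continuous_on UNIV (damping c)"
    unfolding damping_def by (intro continuous_intros)
  then show ?thesis by (rule borel_measurable_continuous_onI)
qed

lemma damping_integrable:
  assumes c: "continuous_on UNIV c" "\<And>s. \<bar>c s\<bar> \<le> L"
    "\<And>s. S \<le> s \<Longrightarrow> \<kappa> \<le> c s" "\<And>s. s \<le> - S \<Longrightarrow> c s \<le> - \<kappa>" and "0 \<le> S" "0 < \<kappa>"
  shows "integrable lborel (damping c)"
proof (rule Bochner_Integration.integrable_bound)
  show "integrable lborel (\<lambda>s. exp ((L + \<kappa>) * S) * exp (- (\<kappa> * \<bar>s\<bar>)))"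
    by (intro Bochner_Integration.integrable_mult_right integrable_exp_neg_abs assms)
  show "damping c \<in> borel_measurable lborel" using damping_measurable[OF c(1)] by simp
  show "AE s in lborel. norm (damping c s) \<le> norm (exp ((L + \<kappa>) * S) * exp (- (\<kappa> * \<bar>s\<bar>)))"
    using damping_le[OF assms] by (simp add: damping_def)
qed

lemma weighted_forcing_measurable:
  assumes "continuous_on UNIV c" "continuous_on UNIV y"
  shows "(\<lambda>s. damping c s * (cos (arctan s) * sin (y s))) \<in> borel_measurable borel"
proof -
  have "(\<lambda>s. cos (arctan s) * sin (y s)) \<in> borel_measurable borel"
    by (intro borel_measurable_continuous_onI continuous_intros assms)
  then show ?thesis using damping_measurable[OF assms(1)] by measurable
qed

lemma abs_weighted_forcing_le: "\<bar>damping c s * (cos (arctan s) * sin y)\<bar> \<le> damping c s"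
  using abs_mult_mult_le[of "cos (arctan s)" "sin y" "damping c s"] by (simp add: mult.assoc damping_def)

lemma weighted_forcing_integrable:
  assumes "continuous_on UNIV c" "continuous_on UNIV y" "integrable lborel (damping c)"
  shows "integrable lborel (\<lambda>s. damping c s * (cos (arctan s) * sin (y s)))"
  by (rule Bochner_Integration.integrable_bound[OF assms(3)])
     (use weighted_forcing_measurable[OF assms(1,2)] abs_weighted_forcing_le[THEN order_trans[OF _ abs_ge_self]] in auto)

text \<open>Along two connectors the difference \<open>D = y2 - y1\<close> solves a linear equation, with the integrating
  factor \<open>damping\<close>, which decays at both ends because of the hyperbolicity of the saddles. Hence the
  forcing term has weighted mean zero.\<close>

lemma connector_mean_zero:
  assumes y: "orbit a \<gamma> E1 \<mu>1 y1" "orbit a \<gamma> E2 \<mu>2 y2"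
  defines "c \<equiv> \<lambda>s. slope_quot a \<mu>1 s (y1 s) (y2 s)"
  assumes S: "0 < \<kappa>" "0 \<le> S"
    and right: "\<And>s. S \<le> s \<Longrightarrow> \<kappa> \<le> c s" "\<And>s. S \<le> s \<Longrightarrow> \<bar>y2 s - y1 s\<bar> \<le> 1"
    and left: "\<And>s. s \<le> - S \<Longrightarrow> c s \<le> - \<kappa>" "\<And>s. s \<le> - S \<Longrightarrow> \<bar>y2 s - y1 s\<bar> \<le> 1"
  shows "a * (E2 - E1) * (LINT s|lborel. damping c s) =
     (\<mu>2 - \<mu>1) * (LINT s|lborel. damping c s * (cos (arctan s) * sin (y2 s)))"
proof -
  have cont: "continuous_on UNIV y1" "continuous_on UNIV y2" using y orbit_continuous by auto
  have c: "continuous_on UNIV c" unfolding c_def by (intro slope_quot_continuous cont)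
  have c_le: "\<bar>c s\<bar> \<le> 2 * \<bar>a\<bar> + 2 * \<bar>\<mu>1\<bar>" for s unfolding c_def by (rule abs_slope_quot_le)
  define K where "K = exp ((2 * \<bar>a\<bar> + 2 * \<bar>\<mu>1\<bar> + \<kappa>) * S)"
  have w_le: "damping c s \<le> K * exp (- (\<kappa> * \<bar>s\<bar>))" for s
    unfolding K_def by (rule damping_le[OF c c_le right(1) left(1) S(2,1)])
  have w0: "0 < damping c s" for s by (simp add: damping_def)
  have int1: "integrable lborel (damping c)"
    by (rule damping_integrable[OF c c_le right(1) left(1) S(2,1)])
  have int2: "integrable lborel (\<lambda>s. damping c s * (cos (arctan s) * sin (y2 s)))"
    by (rule weighted_forcing_integrable[OF c cont(2) int1])
  define f where "f = (\<lambda>s. 2 * (\<mu>2 - \<mu>1) * (damping c s * (cos (arctan s) * sin (y2 s))) - 2 * a * (E2 - E1) * damping c s)"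
  define F where "F = (\<lambda>s. damping c s * (y2 s - y1 s))"
  have f_int: "integrable lborel f"
    unfolding f_def by (intro Bochner_Integration.integrable_diff Bochner_Integration.integrable_mult_right int1 int2)
  have F: "(F has_real_derivative f s) (at s)" for s
    unfolding F_def damping_def
    by (rule derivative_eq_intros DERIV_primitive[OF c] orbit_diff_deriv[OF y] refl)+
       (simp add: f_def damping_def c_def algebra_simps)
  have f_cont: "isCont f s" for s
  proof -
    have "isCont (damping c) s"
      unfolding damping_def using DERIV_isCont[OF DERIV_primitive[OF c]] by (intro continuous_intros)
    moreover have "isCont y2 s" using cont by (simp add: continuous_on_eq_continuous_at)
    ultimately show ?thesis unfolding f_def by (intro continuous_intros)
  qed
  have F_le: "\<bar>F s\<bar> \<le> K * exp (- (\<kappa> * \<bar>s\<bar>))" if "S \<le> s \<or> s \<le> - S" for s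
  proof -
    have "\<bar>F s\<bar> \<le> damping c s * 1"
      unfolding F_def abs_mult using w0[of s] right(2)[of s] left(2)[of s] that by (intro mult_mono) auto
    then show ?thesis using w_le[of s] by simp
  qed
  have top: "(F \<longlongrightarrow> 0) at_top"
  proof (rule Lim_null_comparison)
    show "\<forall>\<^sub>F s in at_top. norm (F s) \<le> K * exp (- (\<kappa> * \<bar>s\<bar>))"
      using F_le by (auto simp: eventually_at_top_linorder)
    show "((\<lambda>s. K * exp (- (\<kappa> * \<bar>s\<bar>))) \<longlongrightarrow> 0) at_top"
      using S(1) by real_asymp
  qed
  have bot: "(F \<longlongrightarrow> 0) at_bot"
  proof (rule Lim_null_comparison)
    show "\<forall>\<^sub>F s in at_bot. norm (F s) \<le> K * exp (- (\<kappa> * \<bar>s\<bar>))"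
      using F_le by (auto simp: eventually_at_bot_linorder)
    show "((\<lambda>s. K * exp (- (\<kappa> * \<bar>s\<bar>))) \<longlongrightarrow> 0) at_bot"
      using S(1) by real_asymp
  qed
  have "(LBINT s=-\<infinity>..\<infinity>. f s) = 0 - 0"
  proof (rule interval_integral_FTC_integrable)
    show "(F has_vector_derivative f s) (at s)" for s
      using F by (simp add: has_real_derivative_iff_has_vector_derivative)
    show "set_integrable lborel (einterval (-\<infinity>) \<infinity>) f"
      using f_int by (simp add: set_integrable_def einterval_def)
  qed (use f_cont top bot in \<open>auto simp: ereal_tendsto_simps\<close>)
  then have "(LINT s|lborel. f s) = 0"
    by (simp add: interval_lebesgue_integral_def set_lebesgue_integral_def einterval_def)
  moreover have "(LINT s|lborel. f s) = 2 * (\<mu>2 - \<mu>1) * (LINT s|lborel. damping c s * (cos (arctan s) * sin (y2 s)))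
     - 2 * a * (E2 - E1) * (LINT s|lborel. damping c s)"
    unfolding f_def
    by (subst Bochner_Integration.integral_diff) (auto intro!: Bochner_Integration.integrable_mult_right int1 int2)
  ultimately show ?thesis by (simp add: algebra_simps)
qed

text \<open>Two sequences of connectors are allowed so that one statement serves twice: with equal
  sequences for the continuity of the derivative, and with one of them constant for difference
  quotients. The limit coefficient \<open>c0\<close>, the quotient on the diagonal, is the
  derivative of \<open>slope\<close> in \<open>y\<close> along the limiting connector.\<close>

lemma connector_mean_tendsto:
  fixes a E \<mu> :: real and e e' m m' :: "nat \<Rightarrow> real" and y :: "real \<Rightarrow> real" and u v :: "nat \<Rightarrow> real \<Rightarrow> real"
  defines "c \<equiv> \<lambda>n s. slope_quot a (m n) s (u n s) (v n s)"
    and "c0 \<equiv> \<lambda>s. slope_quot a \<mu> s (y s) (y s)"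
  assumes a: "0 < a" and E: "-1 < E" "E < 1" and y: "connector a \<gamma> E \<mu> y"
    and u: "\<And>n. connector a \<gamma> (e n) (m n) (u n)" and v: "\<And>n. connector a \<gamma> (e' n) (m' n) (v n)"
    and lim: "e \<longlonglongrightarrow> E" "m \<longlonglongrightarrow> \<mu>" "e' \<longlonglongrightarrow> E" "m' \<longlonglongrightarrow> \<mu>"
  shows "(\<lambda>n. LINT s|lborel. damping (c n) s) \<longlonglongrightarrow> (LINT s|lborel. damping c0 s)" (is ?I)
    and "(\<lambda>n. LINT s|lborel. damping (c n) s * (cos (arctan s) * sin (v n s)))
           \<longlonglongrightarrow> (LINT s|lborel. damping c0 s * (cos (arctan s) * sin (y s)))" (is ?J)
    and "\<forall>\<^sub>F n in sequentially. a * (e' n - e n) * (LINT s|lborel. damping (c n) s) =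
           (m' n - m n) * (LINT s|lborel. damping (c n) s * (cos (arctan s) * sin (v n s)))" (is ?mean)
proof -
  from lim have "Bseq m" "Bseq m'" by (auto intro: convergent_imp_Bseq convergentI)
  then obtain M1 M2 where M12: "\<forall>n. norm (m n) \<le> M1" "\<forall>n. norm (m' n) \<le> M2"
    by (metis BseqE)
  define M where "M = max M1 M2"
  have M: "\<bar>m n\<bar> \<le> M" "\<bar>m' n\<bar> \<le> M" for n
    using M12 by (auto simp: M_def le_max_iff_disj)
  obtain \<kappa> S \<delta> where S: "0 < \<kappa>" "0 \<le> S" "0 < \<delta>"
    and bounds: "\<And>E1 E2 \<mu>1 \<mu>2 y1 y2. \<bar>E1 - E\<bar> < \<delta> \<Longrightarrow> \<bar>E2 - E\<bar> < \<delta> \<Longrightarrow>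
     \<bar>\<mu>1\<bar> \<le> M \<Longrightarrow> \<bar>\<mu>2\<bar> \<le> M \<Longrightarrow> connector a \<gamma> E1 \<mu>1 y1 \<Longrightarrow> connector a \<gamma> E2 \<mu>2 y2 \<Longrightarrow>
     (\<forall>s\<ge>S. \<kappa> \<le> slope_quot a \<mu>1 s (y1 s) (y2 s) \<and> \<bar>y2 s - y1 s\<bar> \<le> 1) \<and>
     (\<forall>s\<le>-S. slope_quot a \<mu>1 s (y1 s) (y2 s) \<le> - \<kappa> \<and> \<bar>y2 s - y1 s\<bar> \<le> 1)"
    using connector_slope_quot_bounds[OF a E, of M \<gamma>] by metis
  have "\<forall>\<^sub>F n in sequentially. \<bar>e n - E\<bar> < \<delta>" "\<forall>\<^sub>F n in sequentially. \<bar>e' n - E\<bar> < \<delta>"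
    using tendstoD[OF lim(1) S(3)] tendstoD[OF lim(3) S(3)] by (simp_all add: dist_real_def)
  then have "\<forall>\<^sub>F n in sequentially. \<bar>e n - E\<bar> < \<delta> \<and> \<bar>e' n - E\<bar> < \<delta>"
    by (rule eventually_conj)
  then obtain N where N: "\<And>n. N \<le> n \<Longrightarrow> \<bar>e n - E\<bar> < \<delta>" "\<And>n. N \<le> n \<Longrightarrow> \<bar>e' n - E\<bar> < \<delta>"
    by (auto simp: eventually_sequentially)
  have b: "(\<forall>s\<ge>S. \<kappa> \<le> c n s \<and> \<bar>v n s - u n s\<bar> \<le> 1) \<and> (\<forall>s\<le>-S. c n s \<le> - \<kappa> \<and> \<bar>v n s - u n s\<bar> \<le> 1)"
    if "N \<le> n" for n
    unfolding c_def by (rule bounds[OF N(1)[OF that] N(2)[OF that] M u v])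
  have cont: "continuous_on UNIV (u n)" "continuous_on UNIV (v n)" "continuous_on UNIV y" for n
    using u v y connector_orbit orbit_continuous by blast+
  have c: "continuous_on UNIV (c n)" and c0: "continuous_on UNIV c0" for n
    unfolding c_def c0_def by (intro slope_quot_continuous cont)+
  define L where "L = 2 * \<bar>a\<bar> + 2 * M"
  have c_le: "\<bar>c n s\<bar> \<le> L" for n s
    using abs_slope_quot_le[of a "m n" s "u n s" "v n s"] M(1)[of n] by (simp add: c_def L_def)
  have uv: "(\<lambda>n. u n s) \<longlonglongrightarrow> y s" "(\<lambda>n. v n s) \<longlonglongrightarrow> y s" for s
    using u v y unfolding connector_def
    by (blast intro: stable_orbit_tendsto[OF a E _ _ lim(1,2)] stable_orbit_tendsto[OF a E _ _ lim(3,4)])+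
  have "(\<lambda>n. c n s) \<longlonglongrightarrow> c0 s" for s
  proof -
    have "(\<lambda>n. sinc ((v n s - u n s) / 2)) \<longlonglongrightarrow> sinc ((y s - y s) / 2)"
      by (rule isCont_tendsto_compose[OF isCont_sinc]) (intro tendsto_intros uv, simp)
    then show ?thesis
      unfolding c_def c0_def slope_quot_def by (intro tendsto_mult[of "\<lambda>n. sinc ((v n s - u n s) / 2)"] tendsto_intros uv lim) auto
  qed
  then have damp: "(\<lambda>n. damping (c n) s) \<longlonglongrightarrow> damping c0 s" for s
    unfolding damping_def by (intro tendsto_intros primitive_tendsto[OF c c0 c_le])
  have dom: "integrable lborel (\<lambda>s. exp ((L + \<kappa>) * S) * exp (- (\<kappa> * \<bar>s\<bar>)))"
    by (intro Bochner_Integration.integrable_mult_right integrable_exp_neg_abs S)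
  \<comment> \<open>The domination is available from index \<open>N\<close> on; the shift by
    \<open>N\<close> is undone by \<open>LIMSEQ_offset\<close>.\<close>
  have le: "damping (c (n + N)) s \<le> exp ((L + \<kappa>) * S) * exp (- (\<kappa> * \<bar>s\<bar>))" for n s
    by (rule damping_le[OF c c_le]) (use b[of "n + N"] S in auto)
  have "(\<lambda>n. LINT s|lborel. damping (c (n + N)) s) \<longlonglongrightarrow> (LINT s|lborel. damping c0 s)"
  proof (rule integral_dominated_convergence[OF _ _ dom])
    show "AE s in lborel. (\<lambda>n. damping (c (n + N)) s) \<longlonglongrightarrow> damping c0 s"
      using LIMSEQ_ignore_initial_segment[OF damp] by simp
    show "AE s in lborel. norm (damping (c (n + N)) s) \<le> exp ((L + \<kappa>) * S) * exp (- (\<kappa> * \<bar>s\<bar>))" for n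
      using le by (simp add: damping_def)
  qed (use damping_measurable[OF c] damping_measurable[OF c0] in auto)
  then show ?I by (rule LIMSEQ_offset)
  have "(\<lambda>n. LINT s|lborel. damping (c (n + N)) s * (cos (arctan s) * sin (v (n + N) s)))
           \<longlonglongrightarrow> (LINT s|lborel. damping c0 s * (cos (arctan s) * sin (y s)))"
  proof (rule integral_dominated_convergence[OF _ _ dom])
    have "(\<lambda>n. damping (c n) s * (cos (arctan s) * sin (v n s)))
        \<longlonglongrightarrow> damping c0 s * (cos (arctan s) * sin (y s))" for s
      by (intro tendsto_intros damp uv)
    from LIMSEQ_ignore_initial_segment[OF this]
    show "AE s in lborel. (\<lambda>n. damping (c (n + N)) s * (cos (arctan s) * sin (v (n + N) s)))
        \<longlonglongrightarrow> damping c0 s * (cos (arctan s) * sin (y s))" by simp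
    show "AE s in lborel. norm (damping (c (n + N)) s * (cos (arctan s) * sin (v (n + N) s)))
        \<le> exp ((L + \<kappa>) * S) * exp (- (\<kappa> * \<bar>s\<bar>))" for n
      using order_trans[OF abs_weighted_forcing_le le] by simp
  qed (use weighted_forcing_measurable[OF c cont(2)] weighted_forcing_measurable[OF c0 cont(3)] in auto)
  then show ?J by (rule LIMSEQ_offset)
  show ?mean
    unfolding eventually_sequentially
  proof (intro exI allI impI)
    fix n assume "N \<le> n"
    show "a * (e' n - e n) * (LINT s|lborel. damping (c n) s) =
           (m' n - m n) * (LINT s|lborel. damping (c n) s * (cos (arctan s) * sin (v n s)))"
      unfolding c_def
      by (rule connector_mean_zero[OF connector_orbit[OF u] connector_orbit[OF v] S(1,2)])
         (use b[OF \<open>N \<le> n\<close>] in \<open>auto simp: c_def\<close>)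
  qed
qed

text \<open>The factor \<open>cos (arctan s) * sin (y s)\<close> has absolute value below 1 for
  every \<open>s \<noteq> 0\<close>. Integrating the weight times \<open>1 - factor\<close> and
  \<open>1 + factor\<close> gives the two strict inequalities, and with them the strictness in the
  bound \<open>1 / a\<close>.\<close>

lemma connector_mean_bounds:
  fixes a \<mu> :: real and y :: "real \<Rightarrow> real"
  defines "c \<equiv> \<lambda>s. slope_quot a \<mu> s (y s) (y s)"
  assumes a: "0 < a" and E: "-1 < E" "E < 1" and y: "connector a \<gamma> E \<mu> y"
  shows "0 < (LINT s|lborel. damping c s)"
    and "\<bar>LINT s|lborel. damping c s * (cos (arctan s) * sin (y s))\<bar> < (LINT s|lborel. damping c s)"
proof -
  obtain \<kappa> S \<delta> where S: "0 < \<kappa>" "0 \<le> S" "0 < \<delta>"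
    and bounds: "\<And>E1 E2 \<mu>1 \<mu>2 y1 y2. \<bar>E1 - E\<bar> < \<delta> \<Longrightarrow> \<bar>E2 - E\<bar> < \<delta> \<Longrightarrow>
     \<bar>\<mu>1\<bar> \<le> \<bar>\<mu>\<bar> \<Longrightarrow> \<bar>\<mu>2\<bar> \<le> \<bar>\<mu>\<bar> \<Longrightarrow> connector a \<gamma> E1 \<mu>1 y1 \<Longrightarrow> connector a \<gamma> E2 \<mu>2 y2 \<Longrightarrow>
     (\<forall>s\<ge>S. \<kappa> \<le> slope_quot a \<mu>1 s (y1 s) (y2 s) \<and> \<bar>y2 s - y1 s\<bar> \<le> 1) \<and>
     (\<forall>s\<le>-S. slope_quot a \<mu>1 s (y1 s) (y2 s) \<le> - \<kappa> \<and> \<bar>y2 s - y1 s\<bar> \<le> 1)"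
    using connector_slope_quot_bounds[OF a E, of "\<bar>\<mu>\<bar>" \<gamma>] by metis
  have b: "(\<forall>s\<ge>S. \<kappa> \<le> c s) \<and> (\<forall>s\<le>-S. c s \<le> - \<kappa>)"
    using bounds[OF _ _ order_refl order_refl y y] S(3) unfolding c_def by simp
  have cont: "continuous_on UNIV y" by (rule orbit_continuous[OF connector_orbit[OF y]])
  have c: "continuous_on UNIV c" unfolding c_def by (intro slope_quot_continuous cont)
  have int1: "integrable lborel (damping c)"
    by (rule damping_integrable[OF c _ _ _ S(2,1)]) (use b abs_slope_quot_le[of a \<mu>] in \<open>auto simp: c_def\<close>)
  have int2: "integrable lborel (\<lambda>s. damping c s * (cos (arctan s) * sin (y s)))"
    by (rule weighted_forcing_integrable[OF c cont int1])
  have w0: "0 < damping c s" for s by (simp add: damping_def)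
  show "0 < (LINT s|lborel. damping c s)"
    by (rule LINT_pos[OF int1]) (use w0 in \<open>auto simp: less_imp_le\<close>)
  have strict: "\<bar>damping c s * (cos (arctan s) * sin (y s))\<bar> < damping c s" if "s \<noteq> 0" for s
  proof -
    have "1 < sqrt (1 + s\<^sup>2)" using that by simp
    then have "cos (arctan s) < 1" unfolding cos_arctan by (subst divide_less_eq_1_pos) linarith+
    moreover have "\<bar>cos (arctan s) * sin (y s)\<bar> \<le> cos (arctan s)"
      using cos_arctan_gt_0[of s] by (simp add: abs_mult mult_left_le)
    ultimately have "\<bar>cos (arctan s) * sin (y s)\<bar> < 1" by linarith
    then show ?thesis using w0[of s] by (simp add: abs_mult[of "damping c s"])
  qed
  have "0 < (LINT s|lborel. damping c s - damping c s * (cos (arctan s) * sin (y s)))"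
  proof (rule LINT_pos)
    show "0 \<le> damping c s - damping c s * (cos (arctan s) * sin (y s))" for s
      using abs_weighted_forcing_le[of c s "y s"] unfolding abs_le_iff by linarith
    show "0 < damping c s - damping c s * (cos (arctan s) * sin (y s))" if "s \<noteq> 0" for s
      using strict[OF that] by linarith
  qed (intro Bochner_Integration.integrable_diff int1 int2)
  moreover have "0 < (LINT s|lborel. damping c s + damping c s * (cos (arctan s) * sin (y s)))"
  proof (rule LINT_pos)
    show "0 \<le> damping c s + damping c s * (cos (arctan s) * sin (y s))" for s
      using abs_weighted_forcing_le[of c s "y s"] unfolding abs_le_iff by linarith
    show "0 < damping c s + damping c s * (cos (arctan s) * sin (y s))" if "s \<noteq> 0" for s
      using strict[OF that] by linarith
  qed (intro Bochner_Integration.integrable_add int1 int2)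
  ultimately show "\<bar>LINT s|lborel. damping c s * (cos (arctan s) * sin (y s))\<bar> < (LINT s|lborel. damping c s)"
    using int1 int2 by (simp add: abs_less_iff)
qed

theorem theorem8:
  fixes a \<gamma> :: real
  assumes "0 < a" "a < 1 / 2"
    and "- sqrt (2 * a * (1 - 2 * a)) < \<gamma>" "\<gamma> < 0"
  shows "\<exists>\<E> \<E>' :: real \<Rightarrow> real.
     (\<forall>\<mu> \<in> {-1 - a .. -1 + a}.
        \<E> \<mu> \<in> {0 <..< 1} \<and> has_saddles_connector a \<gamma> (\<E> \<mu>) \<mu> \<and>
        (\<forall>E \<in> {0 <..< 1}. has_saddles_connector a \<gamma> E \<mu> \<longrightarrow> E = \<E> \<mu>)) \<and>
     continuous_on {-1 - a .. -1 + a} \<E>' \<and>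
     (\<forall>\<mu> \<in> {-1 - a .. -1 + a}.
        (\<E> has_real_derivative \<E>' \<mu>) (at \<mu> within {-1 - a .. -1 + a}) \<and>
        \<bar>\<E>' \<mu>\<bar> < 1 / a)"
proof -
  define R where "R = {-1 - a .. -1 + a}"
  \<comment> \<open>Rearranged, this says \<open>(2 * a - 1/2)\<^sup>2 \<ge> 0\<close>.\<close>
  have "2 * a * (1 - 2 * a) \<le> (1/2)\<^sup>2"
    using zero_le_power2[of "2 * a - 1/2"] by (simp add: power2_eq_square algebra_simps)
  then have "sqrt (2 * a * (1 - 2 * a)) \<le> 1/2" by (intro real_le_lsqrt) simp_all
  then have \<gamma>: "\<bar>\<gamma>\<bar> < 1 / 2" using assms by linarith
  have "\<exists>E y. 0 < E \<and> E < 1 \<and> connector a \<gamma> E \<mu> y" if "\<mu> \<in> R" for \<mu>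
    using connector_exists[OF assms(1,2) \<gamma> assms(4), of \<mu>] that by (simp add: connector_def R_def)
  then obtain \<E> Y where \<E>: "\<And>\<mu>. \<mu> \<in> R \<Longrightarrow> 0 < \<E> \<mu>" "\<And>\<mu>. \<mu> \<in> R \<Longrightarrow> \<E> \<mu> < 1"
    and Y: "\<And>\<mu>. \<mu> \<in> R \<Longrightarrow> connector a \<gamma> (\<E> \<mu>) \<mu> (Y \<mu>)"
    by metis
  have \<E>_gt: "-1 < \<E> \<mu>" if "\<mu> \<in> R" for \<mu> using \<E>(1)[OF that] by simp
  have diff_le: "\<bar>E2 - E1\<bar> \<le> \<bar>\<mu>2 - \<mu>1\<bar> / a"
    if "0 < E1" "E1 < 1" "0 < E2" "E2 < 1" "connector a \<gamma> E1 \<mu>1 y1" "connector a \<gamma> E2 \<mu>2 y2"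
    for E1 E2 \<mu>1 \<mu>2 y1 y2
  proof -
    have "a * (E2 - E1) \<le> \<bar>\<mu>2 - \<mu>1\<bar>" "a * (E1 - E2) \<le> \<bar>\<mu>1 - \<mu>2\<bar>"
      using that by (auto intro!: connector_energy_diff_le[OF assms(1)] simp: connector_def)
    then have "a * \<bar>E2 - E1\<bar> \<le> \<bar>\<mu>2 - \<mu>1\<bar>" by (simp add: abs_if split: if_splits)
    then show ?thesis using assms(1) by (simp add: field_simps)
  qed
  have unique: "E = \<E> \<mu>" if "\<mu> \<in> R" "0 < E" "E < 1" and conn: "has_saddles_connector a \<gamma> E \<mu>" for E \<mu>
  proof -
    obtain y where "connector a \<gamma> E \<mu> y" using conn by (auto simp: has_saddles_connector_iff connector_def)
    from diff_le[OF that(2,3) \<E>[OF that(1)] this Y[OF that(1)]] show ?thesis by simp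
  qed
  have \<E>_lim: "(\<lambda>n. \<E> (m n)) \<longlonglongrightarrow> \<E> \<mu>" if "\<mu> \<in> R" "\<And>n. m n \<in> R" "m \<longlonglongrightarrow> \<mu>" for \<mu> m
  proof -
    have "(\<lambda>n. \<bar>m n - \<mu>\<bar> / a) \<longlonglongrightarrow> \<bar>\<mu> - \<mu>\<bar> / a"
      by (intro tendsto_intros that) (use assms in auto)
    moreover have "\<bar>\<E> (m n) - \<E> \<mu>\<bar> \<le> \<bar>m n - \<mu>\<bar> / a" for n
      by (rule diff_le[OF \<E>[OF that(1)] \<E>[OF that(2)] Y[OF that(1)] Y[OF that(2)]])
    ultimately have "(\<lambda>n. \<E> (m n) - \<E> \<mu>) \<longlonglongrightarrow> 0"
      by (intro Lim_null_comparison[of "\<lambda>n. \<E> (m n) - \<E> \<mu>" "\<lambda>n. \<bar>m n - \<mu>\<bar> / a"]) auto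
    then show ?thesis by (simp add: LIM_zero_iff)
  qed
  define I where "I = (\<lambda>\<mu>. LINT s|lborel. damping (\<lambda>s. slope_quot a \<mu> s (Y \<mu> s) (Y \<mu> s)) s)"
  define J where "J = (\<lambda>\<mu>. LINT s|lborel. damping (\<lambda>s. slope_quot a \<mu> s (Y \<mu> s) (Y \<mu> s)) s
     * (cos (arctan s) * sin (Y \<mu> s)))"
  define \<E>' where "\<E>' = (\<lambda>\<mu>. J \<mu> / (a * I \<mu>))"
  have IJ: "0 < I \<mu>" "\<bar>J \<mu>\<bar> < I \<mu>" if "\<mu> \<in> R" for \<mu>
    unfolding I_def J_def by (rule connector_mean_bounds[OF assms(1) \<E>_gt \<E>(2) Y, OF that that that])+
  have bound: "\<bar>\<E>' \<mu>\<bar> < 1 / a" if "\<mu> \<in> R" for \<mu>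
    using IJ[OF that] assms(1) by (simp add: \<E>'_def abs_mult field_simps)
  have cont: "continuous_on R \<E>'"
    unfolding continuous_on_sequentially
  proof (intro allI ballI impI)
    fix m \<mu> assume \<mu>: "\<mu> \<in> R" and m: "(\<forall>n. m n \<in> R) \<and> m \<longlonglongrightarrow> \<mu>"
    have mR: "m n \<in> R" for n using m by simp
    note lim = \<E>_lim[OF \<mu> mR conjunct2[OF m]]
    \<comment> \<open>Both sequences are the connectors at \<open>m n\<close>, so the means are
      exactly \<open>I (m n)\<close> and \<open>J (m n)\<close>.\<close>
    note mean = connector_mean_tendsto[OF assms(1) \<E>_gt[OF \<mu>] \<E>(2)[OF \<mu>] Y[OF \<mu>] Y[OF mR] Y[OF mR]
        lim conjunct2[OF m] lim conjunct2[OF m]]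
    have "(\<lambda>n. J (m n) / (a * I (m n))) \<longlonglongrightarrow> J \<mu> / (a * I \<mu>)"
      using mean(1,2) IJ(1)[OF \<mu>] assms(1) unfolding I_def J_def by (intro tendsto_intros) auto
    then show "(\<E>' \<circ> m) \<longlonglongrightarrow> \<E>' \<mu>" by (simp add: \<E>'_def o_def)
  qed
  have deriv: "(\<E> has_real_derivative \<E>' \<mu>) (at \<mu> within R)" if \<mu>: "\<mu> \<in> R" for \<mu>
    unfolding has_field_derivative_iff tendsto_at_iff_sequentially
  proof (intro allI impI)
    fix m :: "nat \<Rightarrow> real" assume "\<forall>n. m n \<in> R - {\<mu>}" and m: "m \<longlonglongrightarrow> \<mu>"
    then have mR: "m n \<in> R" "m n \<noteq> \<mu>" for n by auto
    define c where "c = (\<lambda>n s. slope_quot a \<mu> s (Y \<mu> s) (Y (m n) s))"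
    \<comment> \<open>Here the first sequence is constant, the connector at \<open>\<mu>\<close>,
      and the second is the one at \<open>m n\<close>: the coefficient \<open>c n\<close> is the
      secant quotient between them.\<close>
    note mean = connector_mean_tendsto[OF assms(1) \<E>_gt[OF \<mu>] \<E>(2)[OF \<mu>] Y[OF \<mu>] Y[OF \<mu>] Y[OF mR(1)]
        tendsto_const tendsto_const \<E>_lim[OF \<mu> mR(1) m] m]
    define In where "In = (\<lambda>n. LINT s|lborel. damping (c n) s)"
    define Jn where "Jn = (\<lambda>n. LINT s|lborel. damping (c n) s * (cos (arctan s) * sin (Y (m n) s)))"
    have In: "In \<longlonglongrightarrow> I \<mu>" and Jn: "Jn \<longlonglongrightarrow> J \<mu>"
      using mean(1,2) unfolding In_def Jn_def I_def J_def c_def .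
    have "\<forall>\<^sub>F n in sequentially. 0 < In n"
      by (rule order_tendstoD[OF In]) (rule IJ(1)[OF \<mu>])
    \<comment> \<open>Since \<open>In n\<close> is eventually positive and
      \<open>m n \<noteq> \<mu>\<close>, the mean identity can be solved for the difference
      quotient, without a remainder term.\<close>
    with mean(3) have "\<forall>\<^sub>F n in sequentially. Jn n / (a * In n) = (\<E> (m n) - \<E> \<mu>) / (m n - \<mu>)"
    proof eventually_elim
      case (elim n)
      have "a * In n \<noteq> 0" "m n - \<mu> \<noteq> 0" using elim(2) assms(1) mR(2)[of n] by auto
      moreover have "Jn n * (m n - \<mu>) = (\<E> (m n) - \<E> \<mu>) * (a * In n)"
        using elim(1) unfolding In_def Jn_def c_def by (simp only: mult_ac)
      ultimately show ?case using frac_eq_eq[THEN iffD2] by blast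
    qed
    moreover have "(\<lambda>n. Jn n / (a * In n)) \<longlonglongrightarrow> \<E>' \<mu>"
      unfolding \<E>'_def by (intro tendsto_intros In Jn) (use IJ(1)[OF \<mu>] assms(1) in auto)
    ultimately have "(\<lambda>n. (\<E> (m n) - \<E> \<mu>) / (m n - \<mu>)) \<longlonglongrightarrow> \<E>' \<mu>"
      by (rule Lim_transform_eventually[rotated])
    then show "((\<lambda>y. (\<E> y - \<E> \<mu>) / (y - \<mu>)) \<circ> m) \<longlonglongrightarrow> \<E>' \<mu>" by (simp add: o_def)
  qed
  show ?thesis
    unfolding R_def[symmetric]
  proof (rule exI[of _ \<E>], rule exI[of _ \<E>'], intro conjI ballI impI)
    fix \<mu> assume \<mu>: "\<mu> \<in> R"
    show "\<E> \<mu> \<in> {0<..<1}" using \<E>[OF \<mu>] by simp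
    show "has_saddles_connector a \<gamma> (\<E> \<mu>) \<mu>"
      using Y[OF \<mu>] by (auto simp: has_saddles_connector_iff connector_def)
    show "E = \<E> \<mu>" if "E \<in> {0<..<1}" "has_saddles_connector a \<gamma> E \<mu>" for E
      using unique[OF \<mu> _ _ that(2)] that(1) by simp
  qed (use cont deriv bound in auto)
qed

end
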